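(* Let $(z_n)_{n\in\mathbb{N}}$ be a sequence of distinct complex numbers in the unit disc $\mathbb{D}$. Assume that for some nondecreasing unbounded function $\psi\colon[1,+\infty)\to(0,+\infty)$ satisfying $\psi(2x)=O(\psi(x))$ as $x\to+\infty$ there is a constant $C_1>0$ such that $$N_{z_n}\Bigl(\frac{1-|z_n|}{2}\Bigr)\le C_1\,\psi\Bigl(\frac{1}{1-|z_n|}\Bigr)\quad\text{for all } n\in\mathbb{N}.$$ Then there exist an analytic function $a$ in $\mathbb{D}$ and a constant $C>0$ satisfying $$\ln M(r,a)\le C\,\tilde\psi\Bigl(\frac{1}{1-r}\Bigr),\quad r\in(0,1),$$ such that the differential equation $f''+a(z)f=0$ possesses a solution $f$, analytic in $\mathbb{D}$, having zeros precisely at the points $z_k$, $k\in\mathbb{N}$.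
   Context: $\mathbb{D}=\{z\in\mathbb{C}:|z|<1\}$. For $g$ analytic in $\mathbb{D}$ and $r\in(0,1)$, $M(r,g)=\max\{|g(z)|:|z|=r\}$ (with $\ln 0=-\infty$). For a sequence $(z_k)$ in $\mathbb{D}$, $\zeta\in\mathbb{D}$ and $t\ge0$, $n_\zeta(t)$ is the number of members $z_k$ of the sequence with $|z_k-\zeta|\le t$, and $N_\zeta(r)=\int_0^r\frac{(n_\zeta(t)-1)^+}{t}\,dt$, where $x^+=\max\{x,0\}$. For a nondecreasing $\psi\colon[1,+\infty)\to(0,+\infty)$, $\tilde\psi(x)=\int_1^x\frac{\psi(t)}{t}\,dt$. *)

theory Defs
  imports "HOL-Complex_Analysis.Complex_Analysis" "HOL-Library.Landau_Symbols"
begin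

text \<open>The supremum is a maximum, since the circle is compact and \<open>g\<close> is continuous on it
  (\<open>Max\<close> is only meaningful for finite sets).\<close>

definition max_modulus :: "real \<Rightarrow> (complex \<Rightarrow> complex) \<Rightarrow> real" where
  "max_modulus r g = (SUP w\<in>sphere 0 r. norm (g w))"

text \<open>Natural logarithm with the convention \<open>ln 0 = -\<infinity>\<close>; on the reals, \<open>ln 0 = 0\<close>.\<close>

definition ln_ext :: "real \<Rightarrow> ereal" where
  "ln_ext x = (if x = 0 then -\<infinity> else ereal (ln x))"

text \<open>The members are counted by their indices, so repeated values count repeatedly. The
  count is \<open>\<infinity>\<close>, not \<open>0\<close>, if infinitely many members lie in the disc.\<close>

definition seq_count :: "(nat \<Rightarrow> complex) \<Rightarrow> complex \<Rightarrow> real \<Rightarrow> ennreal" where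
  "seq_count z \<zeta> t = emeasure (count_space UNIV) {k. norm (z k - \<zeta>) \<le> t}"

text \<open>Subtraction on \<^typ>\<open>ennreal\<close> is truncated at \<open>0\<close> and satisfies \<open>\<infinity> - 1 = \<infinity>\<close>, so
  \<open>x - 1\<close> is the positive part of \<open>x - 1\<close>.\<close>

definition integrated_count :: "(nat \<Rightarrow> complex) \<Rightarrow> complex \<Rightarrow> real \<Rightarrow> ennreal" where
  "integrated_count z \<zeta> r =
     (\<integral>\<^sup>+ t\<in>{0<..r}. ((seq_count z \<zeta> t - 1) / ennreal t) \<partial>lborel)"

definition log_primitive :: "(real \<Rightarrow> real) \<Rightarrow> real \<Rightarrow> real" where
  "log_primitive \<psi> x = integral {1..x} (\<lambda>t. \<psi> t / t)"

end

theory Submission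
  imports Defs
begin

text \<open>
  Put \<open>d\<^sub>k = 1 - |z\<^sub>k|\<close>. The solution is sought in the form \<open>f = P exp g\<close>, where \<open>P\<close> is analytic with
  simple zeros exactly at the \<open>z\<^sub>k\<close>. With \<open>h = g'\<close>,
  \<open>f'' = (P'' + 2 h P' + (h' + h\<^sup>2) P) exp g\<close>, so \<open>f\<close> solves \<open>f'' + a f = 0\<close> with
  \<open>a = - ((P'' + 2 h P') / P + h' + h\<^sup>2)\<close>. This \<open>a\<close> is analytic if and only if
  \<open>h(z\<^sub>k) = - P''(z\<^sub>k) / (2 P'(z\<^sub>k))\<close> for all \<open>k\<close>: an interpolation problem for \<open>h\<close>. What has to be shown is
  that \<open>P\<close>, \<open>h\<close> and the quotient grow at most like \<open>exp (C log_primitive \<psi> (1 / (1 - |w|)))\<close>.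

  All estimates are dyadic. Let \<open>lev w\<close> be the \<open>m\<close> with \<open>2\<^sup>-\<^sup>m\<^sup>-\<^sup>1 < 1 - |w| \<le> 2\<^sup>-\<^sup>m\<close>, let
  \<open>\<Psi> j = \<psi> (2\<^sup>j)\<close> and \<open>T m = \<Psi> 0 + \<dots> + \<Psi> m\<close>; up to constants, \<open>T m\<close> is \<open>log_primitive \<psi> (2\<^sup>m)\<close> away from
  the origin. A function is called moderate if \<open>|f w| \<le> exp (C T (lev w))\<close>. By the doubling condition the
  level may be changed by a constant, so moderate functions form an algebra closed under differentiation.

  The hypothesis on the integrated counting function amounts, up to constants, to
  \<open>\<Sum> ln (d\<^sub>k / (2 |z\<^sub>n - z\<^sub>k|)) \<le> C \<Psi> (lev z\<^sub>k)\<close>, the sum being over the \<open>n \<noteq> k\<close> with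
  \<open>|z\<^sub>n - z\<^sub>k| \<le> d\<^sub>k / 2\<close>. It is used twice: crudely, it bounds the number of zeros near \<open>z\<^sub>k\<close> by a
  multiple of \<open>\<Psi> (lev z\<^sub>k)\<close> (\<open>annulus_packing\<close>, \<open>sum_q_le\<close>), which makes the canonical product moderate
  (\<open>P_upper\<close>); precisely, it bounds the product with the \<open>k\<close>-th factor omitted from below at \<open>z\<^sub>k\<close>
  (\<open>P_lower_at_zero\<close>), hence also \<open>P'(z\<^sub>k)\<close> (\<open>deriv_P_lower\<close>). The lower bounds give the interpolating function as a series
  of Lagrange type (\<open>interpolation\<close>). For the quotient one divides, near a given point, only by the zeros close to
  that point, using the maximum principle on a circle that stays away from these zeros, while the
  remaining part of the product is bounded from below at the point itself (\<open>moderate_division\<close>).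

  Finally, since \<open>log_primitive \<psi> 1 = 0\<close>, the required bound forces \<open>|a(0)| \<le> 1\<close>. Replacing \<open>h\<close> by \<open>h + c P\<close>
  keeps the interpolation property, and a suitable constant \<open>c\<close> gives \<open>a(0) = 0\<close>.
\<close>

section \<open>Auxiliary estimates\<close>

text \<open>A shift by \<open>\<lfloor>x\<rfloor>\<close> reduces the claim to the convergence of \<open>\<Sum>b. 1 / b\<^sup>2\<close>. It matters that the bound
  depends neither on \<open>x\<close> nor on \<open>F\<close>.\<close>

lemma sum_inverse_square_int_le:
  fixes x :: real
  assumes "finite F"
  shows "(\<Sum>a\<in>F. 1 / (1 + \<bar>real_of_int a - x\<bar>)\<^sup>2) \<le> 9"
proof -
  define g where "g b = 1 / (max 1 \<bar>real_of_int b\<bar>)\<^sup>2" for b :: int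
  define c where "c = \<lfloor>x\<rfloor>"
  have g0: "g b \<ge> 0" for b by (simp add: g_def)
  have le: "1 / (1 + \<bar>real_of_int a - x\<bar>)\<^sup>2 \<le> g (a - c)" for a
  proof -
    have cx: "real_of_int c \<le> x" "x < real_of_int c + 1" unfolding c_def by linarith+
    have "max 1 \<bar>real_of_int (a - c)\<bar> \<le> 1 + \<bar>real_of_int a - x\<bar>"
      using cx by simp
    hence "(max 1 \<bar>real_of_int (a - c)\<bar>)\<^sup>2 \<le> (1 + \<bar>real_of_int a - x\<bar>)\<^sup>2"
      by (rule power_mono) simp
    moreover have "(max 1 \<bar>real_of_int (a - c)\<bar>)\<^sup>2 > 0" by simp
    ultimately show ?thesis unfolding g_def by (simp add: frac_le)
  qed
  \<comment> \<open>The correction term makes the induction telescope: \<open>2 / n\<^sup>2 \<le> 4 / n - 4 / (n + 1)\<close>.\<close>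
  have box: "(\<Sum>b\<in>{-int N..int N}. g b) \<le> 9 - 4 / (real N + 1)" for N
  proof (induction N)
    case 0 thus ?case by (simp add: g_def)
  next
    case (Suc N)
    have "{-int (Suc N)..int (Suc N)} = insert (-int (Suc N)) (insert (int (Suc N)) {-int N..int N})"
      by auto
    hence "(\<Sum>b\<in>{-int (Suc N)..int (Suc N)}. g b)
        = g (-int (Suc N)) + (g (int (Suc N)) + (\<Sum>b\<in>{-int N..int N}. g b))"
      by simp
    also have "g (-int (Suc N)) = 1 / (real N + 1)\<^sup>2" by (simp add: g_def add.commute)
    also have "g (int (Suc N)) = 1 / (real N + 1)\<^sup>2" by (simp add: g_def add.commute)
    finally have e: "(\<Sum>b\<in>{-int (Suc N)..int (Suc N)}. g b) \<le> 2 / (real N + 1)\<^sup>2 + (9 - 4 / (real N + 1))"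
      using Suc by simp
    have "2 / (real N + 1)\<^sup>2 \<le> 4 / ((real N + 1) * (real N + 2))"
      by (simp add: divide_simps power2_eq_square)
    also have "\<dots> = 4 / (real N + 1) - 4 / (real N + 2)" by (simp add: divide_simps) 
    finally show ?case using e by (simp add: add.commute)
  qed
  have fin: "finite ((\<lambda>a. a - c) ` F)" using assms by simp
  obtain N where N: "\<And>b. b \<in> (\<lambda>a. a - c) ` F \<Longrightarrow> nat \<bar>b\<bar> \<le> N"
    using fin by (metis (no_types, lifting) finite_imageI finite_nat_set_iff_bounded_le image_eqI)
  have sub: "(\<lambda>a. a - c) ` F \<subseteq> {-int N..int N}" using N by fastforce
  have "(\<Sum>a\<in>F. 1 / (1 + \<bar>real_of_int a - x\<bar>)\<^sup>2) \<le> (\<Sum>a\<in>F. g (a - c))"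
    by (rule sum_mono) (rule le)
  also have "\<dots> = (\<Sum>b\<in>(\<lambda>a. a - c) ` F. g b)"
    by (subst sum.reindex) (auto simp: inj_on_def)
  also have "\<dots> \<le> (\<Sum>b\<in>{-int N..int N}. g b)"
    by (rule sum_mono2) (use sub g0 in auto)
  also have "\<dots> \<le> 9" using box[of N] by (smt (verit) divide_nonneg_nonneg of_nat_0_le_iff)
  finally show ?thesis .
qed

text \<open>Near \<open>0\<close> the factor differs from \<open>1\<close> by at most \<open>3 |u|^(g + 1)\<close>. Away from \<open>0\<close> any constant is absorbed by a
  multiple of \<open>|u|^(g + 1)\<close>, and only the zero at \<open>u = 1\<close> obstructs a lower bound. The free parameter \<open>\<kappa>\<close>
  allows the factor \<open>|1 - u|\<close> to be dropped altogether when it is at least \<open>1 / \<kappa>\<close>.\<close>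

lemma weierstrass_factor_upper_lower:
  fixes g :: nat and \<kappa> :: real
  assumes g: "g \<ge> 3" and \<kappa>: "\<kappa> \<ge> 1"
  obtains C :: real where "C \<ge> 0"
    "\<And>u. norm u \<le> 2 \<Longrightarrow> norm (weierstrass_factor g u) \<le> exp (C * norm u ^ Suc g)"
    "\<And>u. norm u \<le> 2 \<Longrightarrow>
       norm (weierstrass_factor g u) \<ge> exp (- (C * norm u ^ Suc g)) * min 1 (\<kappa> * norm (1 - u))"
proof -
  define H where "H = (\<Sum>k=1..g. (2::real) ^ k / real k)"
  have H0: "H \<ge> 0" unfolding H_def by (intro sum_nonneg) auto
  define C where "C = 6 + (2 + H + ln \<kappa>) * 2 ^ Suc g"
  have lnk: "ln \<kappa> \<ge> 0" using \<kappa> by simp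
  have CC: "C \<ge> 6" "C \<ge> (2 + H + ln \<kappa>) * 2 ^ Suc g" unfolding C_def using H0 lnk by auto
  have expo: "norm (\<Sum>k=1..g. u ^ k / of_nat k) \<le> H" if "norm u \<le> 2" for u :: complex
    unfolding H_def
    by (intro sum_norm_le) (auto simp: norm_divide norm_power intro!: divide_right_mono power_mono that)
  have big: "2 + H + ln \<kappa> \<le> C * norm u ^ Suc g" if "norm u \<ge> 1/2" for u :: complex
  proof -
    have "(1/2) ^ Suc g \<le> norm u ^ Suc g" by (rule power_mono) (use that in auto)
    hence "C * (1/2) ^ Suc g \<le> C * norm u ^ Suc g" using CC by (intro mult_left_mono) auto
    moreover have "2 + H + ln \<kappa> \<le> C * (1/2) ^ Suc g"
      using CC(2) by (simp add: power_one_over field_simps)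
    ultimately show ?thesis by linarith
  qed
  have small: "3 * norm u ^ Suc g \<le> 1/2" if "norm u \<le> 1/2" for u :: complex
  proof -
    have "norm u ^ Suc g \<le> (1/2) ^ Suc g" by (rule power_mono) (use that in auto)
    also have "(1/2::real) ^ Suc g \<le> (1/2) ^ 4" by (rule power_decreasing) (use g in auto)
    finally show ?thesis by (simp add: power_eq_if)
  qed
  show ?thesis
  proof (rule that[of C])
    show "C \<ge> 0" using CC by simp
  next
    fix u :: complex assume u: "norm u \<le> 2"
    show "norm (weierstrass_factor g u) \<le> exp (C * norm u ^ Suc g)"
    proof (cases "norm u \<le> 1/2")
      case True
      have "norm (weierstrass_factor g u) \<le> 1 + 3 * norm u ^ Suc g"
        using weierstrass_factor_bound[OF True, of g]
          norm_triangle_ineq[of "weierstrass_factor g u - 1" 1] by simp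
      also have "\<dots> \<le> 1 + C * norm u ^ Suc g" using CC by (intro add_left_mono mult_right_mono) auto
      also have "\<dots> \<le> exp (C * norm u ^ Suc g)" by (rule exp_ge_add_one_self)
      finally show ?thesis .
    next
      case False
      have "norm (weierstrass_factor g u) = norm (1 - u) * exp (Re (\<Sum>k=1..g. u ^ k / of_nat k))"
        by (simp add: weierstrass_factor_def norm_mult)
      also have "\<dots> \<le> exp 2 * exp H"
      proof (rule mult_mono)
        have "norm (1 - u) \<le> 1 + 2" using u norm_triangle_ineq4[of 1 u] by simp
        also have "\<dots> \<le> exp 2" using exp_ge_add_one_self[of 2] by simp
        finally show "norm (1 - u) \<le> exp 2" .
        show "exp (Re (\<Sum>k=1..g. u ^ k / of_nat k)) \<le> exp H"
          using expo[OF u] complex_Re_le_cmod order_trans by (simp del: Re_sum) blast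
      qed auto
      also have "\<dots> = exp (2 + H)" by (simp add: exp_add)
      also have "\<dots> \<le> exp (C * norm u ^ Suc g)" using big[of u] False lnk by simp
      finally show ?thesis .
    qed
    show "norm (weierstrass_factor g u) \<ge> exp (- (C * norm u ^ Suc g)) * min 1 (\<kappa> * norm (1 - u))"
    proof (cases "norm u \<le> 1/2")
      case True
      define x where "x = 3 * norm u ^ Suc g"
      have x: "0 \<le> x" "x \<le> 1/2" using small[OF True] by (auto simp: x_def)
      have "exp (- (C * norm u ^ Suc g)) * min 1 (\<kappa> * norm (1 - u)) \<le> exp (- (C * norm u ^ Suc g))"
        using \<kappa> by (simp add: mult_left_le)
      also have "\<dots> \<le> exp (- (2 * x))"
      proof -
        have "6 * norm u ^ Suc g \<le> C * norm u ^ Suc g" using CC by (intro mult_right_mono) auto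
        thus ?thesis unfolding x_def by simp
      qed
      also have "\<dots> \<le> 1 - x"
      proof -
        have "1 + 2 * x \<le> exp (2 * x)" by (rule exp_ge_add_one_self)
        hence "exp (- (2*x)) \<le> 1 / (1 + 2 * x)" using x by (simp add: exp_minus divide_simps)
        also have "\<dots> \<le> 1 - x"
        proof -
          have "x * x \<le> x * (1/2)" using x by (intro mult_left_mono)
          hence "1 \<le> (1 - x) * (1 + 2 * x)" using x by (simp add: algebra_simps)
          thus ?thesis using x by (simp add: divide_simps)
        qed
        finally show ?thesis .
      qed
      also have "\<dots> \<le> norm (weierstrass_factor g u)"
        using weierstrass_factor_bound[OF True, of g]
          norm_triangle_ineq2[of 1 "1 - weierstrass_factor g u"] 
        by (simp add: norm_minus_commute x_def)
      finally show ?thesis .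
    next
      case False
      have "exp (- (C * norm u ^ Suc g)) * min 1 (\<kappa> * norm (1 - u))
            \<le> exp (- (H + ln \<kappa>)) * (\<kappa> * norm (1 - u))"
        by (rule mult_mono) (use big[of u] False H0 lnk \<kappa> in auto)
      also have "\<dots> = exp (-H) * norm (1 - u)"
        using \<kappa> by (simp add: exp_diff exp_minus field_simps)
      also have "\<dots> \<le> norm (1 - u) * exp (Re (\<Sum>k=1..g. u ^ k / of_nat k))"
      proof -
        have "\<bar>Re (\<Sum>k=1..g. u ^ k / of_nat k)\<bar> \<le> H"
          using expo[OF u] abs_Re_le_cmod order_trans by blast
        hence "- H \<le> Re (\<Sum>k=1..g. u ^ k / of_nat k)" by linarith
        hence "exp (- H) \<le> exp (Re (\<Sum>k=1..g. u ^ k / of_nat k))" by simp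
        hence "norm (1 - u) * exp (-H) \<le> norm (1 - u) * exp (Re (\<Sum>k=1..g. u ^ k / of_nat k))"
          by (intro mult_left_mono) auto
        thus ?thesis by (simp only: mult.commute)
      qed
      also have "\<dots> = norm (weierstrass_factor g u)"
        by (simp add: weierstrass_factor_def norm_mult)
      finally show ?thesis .
    qed
  qed
qed

text \<open>At a common zero the quotient is extended by \<open>deriv f a / deriv g a\<close>, the limit given by l'Hopital's rule, and
  the isolated singularity is removable.\<close>

lemma holomorphic_quotient_simple_zeros:
  assumes S: "open S" and f: "f holomorphic_on S" and g: "g holomorphic_on S"
    and zeros: "\<And>a. a \<in> S \<Longrightarrow> g a = 0 \<Longrightarrow> f a = 0 \<and> deriv g a \<noteq> 0"
  obtains F where "F holomorphic_on S" "\<And>w. w \<in> S \<Longrightarrow> f w = F w * g w"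
proof -
  define F where "F w = (if g w = 0 then deriv f w / deriv g w else f w / g w)" for w
  have df: "(f has_field_derivative deriv f a) (at a)" if "a \<in> S" for a
    by (rule holomorphic_derivI[OF f S that])
  have dg: "(g has_field_derivative deriv g a) (at a)" if "a \<in> S" for a
    by (rule holomorphic_derivI[OF g S that])
  have loc: "\<exists>T. open T \<and> a \<in> T \<and> T \<subseteq> S \<and> F holomorphic_on T" if a: "a \<in> S" for a
  proof -
    have punct: "eventually (\<lambda>w. g w \<noteq> 0) (at a)"
    proof (cases "g a = 0")
      case True
      have "((\<lambda>w. (g w - g a) / (w - a)) \<longlongrightarrow> deriv g a) (at a)"
        using dg[OF a] by (simp add: has_field_derivative_iff)
      hence "eventually (\<lambda>w. (g w - g a) / (w - a) \<noteq> 0) (at a)"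
        using zeros[OF a True] by (intro tendsto_imp_eventually_ne) auto
      thus ?thesis by eventually_elim (use True in auto)
    next
      case False
      have "(g \<longlongrightarrow> g a) (at a)" using dg[OF a] DERIV_isCont isCont_def by blast
      thus ?thesis using False by (rule tendsto_imp_eventually_ne)
    qed
    moreover have "eventually (\<lambda>w. w \<in> S) (at a)" using S a by (rule eventually_at_in_open')
    ultimately have "eventually (\<lambda>w. g w \<noteq> 0 \<and> w \<in> S) (at a)" by eventually_elim auto
    then obtain e where e: "e > 0" "\<And>w. w \<noteq> a \<Longrightarrow> dist w a < e \<Longrightarrow> g w \<noteq> 0 \<and> w \<in> S"
      by (auto simp: eventually_at)
    have sub: "ball a e \<subseteq> S" using e(2) a by (auto simp: dist_commute) (metis dist_commute)
    have "F holomorphic_on ball a e"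
    proof (rule no_isolated_singularity')
      show "finite {a}" by simp
      have "(\<lambda>w. f w / g w) holomorphic_on ball a e - {a}"
        by (intro holomorphic_intros holomorphic_on_subset[OF f] holomorphic_on_subset[OF g])
          (use sub e(2) in \<open>auto simp: dist_commute\<close>)
      thus "F holomorphic_on ball a e - {a}"
        by (rule holomorphic_transform) (use e(2) in \<open>auto simp: F_def dist_commute\<close>)
      fix b assume "b \<in> {a}"
      hence b: "b = a" by simp
      have "((\<lambda>w. f w / g w) \<longlongrightarrow> F a) (at a)"
      proof (cases "g a = 0")
        case True
        show ?thesis
          by (rule lhopital_complex_simple[OF df[OF a] dg[OF a]]) (use zeros[OF a True] True in \<open>auto simp: F_def\<close>)
      next
        case False
        have "(f \<longlongrightarrow> f a) (at a)" "(g \<longlongrightarrow> g a) (at a)"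
          using df[OF a] dg[OF a] DERIV_isCont isCont_def by blast+
        thus ?thesis using False by (auto simp: F_def intro!: tendsto_intros)
      qed
      moreover have "eventually (\<lambda>w. f w / g w = F w) (at a)"
        using punct by eventually_elim (simp add: F_def)
      ultimately have "(F \<longlongrightarrow> F a) (at a)" by (rule Lim_transform_eventually)
      thus "(F \<longlongrightarrow> F b) (at b within ball a e)" unfolding b by (rule tendsto_within_subset) simp
    qed simp
    thus ?thesis using e(1) sub by (intro exI[of _ "ball a e"]) auto
  qed
  have "F holomorphic_on S"
    unfolding holomorphic_on_def
  proof
    fix a assume a: "a \<in> S"
    then obtain T where T: "open T" "a \<in> T" "F holomorphic_on T" using loc by blast
    have "F field_differentiable at a" by (rule holomorphic_on_imp_differentiable_at[OF T(3,1,2)])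
    thus "F field_differentiable at a within S" by (rule field_differentiable_at_within)
  qed
  moreover have "f w = F w * g w" if "w \<in> S" for w
    using zeros[OF that] by (auto simp: F_def)
  ultimately show ?thesis by (rule that)
qed

text \<open>The equation for the constant \<open>c\<close> in the normalisation \<open>a 0 = 0\<close> degenerates to a linear one when the
  origin is a prescribed zero.\<close>

lemma quadratic_root_exists:
  fixes \<alpha> \<beta> \<gamma> :: complex
  assumes "\<alpha> \<noteq> 0 \<or> \<beta> \<noteq> 0"
  obtains c where "\<alpha> * c\<^sup>2 + \<beta> * c + \<gamma> = 0"
proof (cases "\<alpha> = 0")
  case True
  thus ?thesis using assms by (intro that[of "- \<gamma> / \<beta>"]) auto
next
  case False
  define D where "D = csqrt (\<beta>\<^sup>2 - 4 * \<alpha> * \<gamma>)"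
  have D: "D\<^sup>2 = \<beta>\<^sup>2 - 4 * \<alpha> * \<gamma>" by (simp add: D_def)
  define c where "c = (D - \<beta>) / (2 * \<alpha>)"
  have "2 * \<alpha> * c + \<beta> = D" using False by (simp add: c_def)
  hence "(2 * \<alpha> * c + \<beta>)\<^sup>2 = \<beta>\<^sup>2 - 4 * \<alpha> * \<gamma>" using D by simp
  hence "4 * \<alpha> * (\<alpha> * c\<^sup>2 + \<beta> * c + \<gamma>) = 0" by (simp add: power2_eq_square algebra_simps)
  thus ?thesis using False that by auto
qed

lemma deriv_deriv_mult_exp:
  fixes p g h :: "complex \<Rightarrow> complex"
  assumes S: "open S" and p: "p holomorphic_on S" and h: "h holomorphic_on S"
    and g: "\<And>w. w \<in> S \<Longrightarrow> (g has_field_derivative h w) (at w)" and w: "w \<in> S"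
  shows "deriv (deriv (\<lambda>w. p w * exp (g w))) w =
    (deriv (deriv p) w + 2 * h w * deriv p w + (deriv h w + (h w)\<^sup>2) * p w) * exp (g w)"
proof -
  have dp: "(p has_field_derivative deriv p v) (at v)"
    and dp': "(deriv p has_field_derivative deriv (deriv p) v) (at v)"
    and dh: "(h has_field_derivative deriv h v) (at v)" if "v \<in> S" for v
    using that p h S by (auto intro!: holomorphic_derivI[where S = S] holomorphic_deriv)
  have d1: "deriv (\<lambda>w. p w * exp (g w)) v = (deriv p v + h v * p v) * exp (g v)" if v: "v \<in> S" for v
    by (rule DERIV_imp_deriv) (auto intro!: derivative_eq_intros dp[OF v] g[OF v] simp: algebra_simps)
  have "deriv (deriv (\<lambda>w. p w * exp (g w))) w = deriv (\<lambda>v. (deriv p v + h v * p v) * exp (g v)) w"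
  proof (rule deriv_cong_ev)
    have "eventually (\<lambda>v. v \<in> S) (nhds w)" using S w by (rule eventually_nhds_in_open)
    thus "eventually (\<lambda>v. deriv (\<lambda>w. p w * exp (g w)) v = (deriv p v + h v * p v) * exp (g v)) (nhds w)"
      by eventually_elim (rule d1)
  qed simp
  also have "\<dots> = (deriv (deriv p) w + 2 * h w * deriv p w + (deriv h w + (h w)\<^sup>2) * p w) * exp (g w)"
    by (rule DERIV_imp_deriv)
      (auto intro!: derivative_eq_intros dp[OF w] dp'[OF w] dh[OF w] g[OF w]
        simp: algebra_simps power2_eq_square)
  finally show ?thesis .
qed

section \<open>Dyadic levels and functions of moderate growth\<close>

text \<open>The dyadic distance to the unit circle: \<open>2^(-m-1) < 1 - |w| \<le> 2^(-m)\<close> for \<open>m = lev w\<close>.\<close>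

definition lev :: "complex \<Rightarrow> nat" where
  "lev w = (LEAST m. 1 < 2 ^ Suc m * (1 - norm w))"

lemma lev_bounds:
  assumes "w \<in> ball 0 1"
  shows lev_gt: "1 < 2 ^ Suc (lev w) * (1 - norm w)" and lev_le: "2 ^ lev w * (1 - norm w) \<le> 1"
proof -
  have pos: "1 - norm w > 0" using assms by simp
  obtain n where "1 / (1 - norm w) < 2 ^ n"
    using real_arch_pow[of 2 "1 / (1 - norm w)"] by auto
  also have "(2::real) ^ n \<le> 2 ^ Suc n" by simp
  finally have "1 < 2 ^ Suc n * (1 - norm w)" using pos by (simp add: divide_simps)
  thus gt: "1 < 2 ^ Suc (lev w) * (1 - norm w)" unfolding lev_def by (rule LeastI)
  show "2 ^ lev w * (1 - norm w) \<le> 1"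
  proof (cases "lev w")
    case 0 thus ?thesis by simp
  next
    case (Suc m)
    hence "m < (LEAST m. 1 < 2 ^ Suc m * (1 - norm w))" unfolding lev_def by simp
    from not_less_Least[OF this] show ?thesis unfolding Suc by simp
  qed
qed

lemma lev_mono:
  assumes w: "w \<in> ball 0 1" and v: "v \<in> ball 0 1" and le: "1 - norm v \<le> 2 ^ i * (1 - norm w)"
  shows "lev w \<le> lev v + i"
proof -
  have "1 < 2 ^ Suc (lev v) * (1 - norm v)" by (rule lev_gt[OF v])
  also have "\<dots> \<le> 2 ^ Suc (lev v) * (2 ^ i * (1 - norm w))" by (intro mult_left_mono le) simp
  also have "\<dots> = 2 ^ Suc (lev v + i) * (1 - norm w)" by (simp add: power_add)
  finally show ?thesis unfolding lev_def[of w] by (rule Least_le)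
qed

text \<open>
  The sequence \<open>\<Psi> j\<close> stands for \<open>\<psi> (2 ^ j)\<close>; the doubling constant is taken to be a power of two so that
  it can be compared directly with dyadic distances.
\<close>

locale growth_scale =
  fixes \<Psi> :: "nat \<Rightarrow> real" and s :: nat
  assumes Psi_pos: "\<And>j. \<Psi> j > 0"
    and Psi_Suc_ge: "\<And>j. \<Psi> j \<le> \<Psi> (Suc j)"
    and Psi_Suc_le: "\<And>j. \<Psi> (Suc j) \<le> 2 ^ s * \<Psi> j"
begin

lemma Psi_mono: "i \<le> j \<Longrightarrow> \<Psi> i \<le> \<Psi> j"
  by (rule lift_Suc_mono_le[of \<Psi>]) (rule Psi_Suc_ge)

lemma Psi_add_le: "\<Psi> (j + i) \<le> 2 ^ (s * i) * \<Psi> j"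
proof (induction i)
  case (Suc i)
  have "\<Psi> (j + Suc i) \<le> 2 ^ s * \<Psi> (j + i)" using Psi_Suc_le[of "j + i"] by simp
  also have "\<dots> \<le> 2 ^ s * (2 ^ (s * i) * \<Psi> j)" by (intro mult_left_mono Suc.IH) simp
  finally show ?case by (simp add: power_add mult_ac)
qed simp

text \<open>The growth scale. In terms of the weight \<open>\<psi>\<close>, it discretises the integral of \<open>\<psi> t / t\<close>, each dyadic interval
  contributing about \<open>\<psi> (2 ^ j) ln 2\<close>.\<close>

definition T :: "nat \<Rightarrow> real" where "T m = (\<Sum>j\<le>m. \<Psi> j)"

lemma T_ge_Psi0: "\<Psi> 0 \<le> T m"
  unfolding T_def by (rule member_le_sum) (auto intro: less_imp_le Psi_pos)

lemma T_pos: "T m > 0" using T_ge_Psi0[of m] Psi_pos[of 0] by linarith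

lemma T_ge_Psi: "\<Psi> m \<le> T m"
  unfolding T_def by (rule member_le_sum) (auto intro: less_imp_le Psi_pos)

lemma T_mono: "i \<le> j \<Longrightarrow> T i \<le> T j"
  unfolding T_def by (rule sum_mono2) (auto intro: less_imp_le Psi_pos)

lemma T_ge_linear: "real (Suc m) * \<Psi> 0 \<le> T m"
proof -
  have "(\<Sum>j\<le>m. \<Psi> 0) \<le> T m" unfolding T_def by (intro sum_mono Psi_mono) simp
  thus ?thesis by simp
qed

text \<open>This is the consequence of doubling that makes the scale insensitive to replacing a point by another one at
  comparable distance to the circle.\<close>

lemma T_shift: "T (m + i) \<le> (1 + 2 ^ s) ^ i * T m"
proof (induction i)
  case (Suc i)
  have "T (m + Suc i) = T (m + i) + \<Psi> (Suc (m + i))" by (simp add: T_def)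
  also have "\<dots> \<le> T (m + i) + 2 ^ s * \<Psi> (m + i)" using Psi_Suc_le by simp
  also have "\<dots> \<le> T (m + i) + 2 ^ s * T (m + i)" using T_ge_Psi by simp
  also have "\<dots> = (1 + 2 ^ s) * T (m + i)" by (simp add: algebra_simps)
  also have "\<dots> \<le> (1 + 2 ^ s) * ((1 + 2 ^ s) ^ i * T m)" by (intro mult_left_mono Suc.IH) (simp add: add_nonneg_nonneg)
  finally show ?case by (simp add: mult_ac)
qed simp

lemma T_diff_le:
  assumes "m \<le> j" shows "T j \<le> T m + real (j - m) * \<Psi> j"
  using assms
proof (induction j rule: dec_induct)
  case (step n)
  have "T (Suc n) = T n + \<Psi> (Suc n)" by (simp add: T_def)
  also have "\<dots> \<le> T m + real (n - m) * \<Psi> n + \<Psi> (Suc n)" using step by simp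
  also have "\<dots> \<le> T m + real (n - m) * \<Psi> (Suc n) + \<Psi> (Suc n)"
    using Psi_Suc_ge[of n] by (simp add: mult_left_mono)
  also have "\<dots> = T m + real (Suc n - m) * \<Psi> (Suc n)" using step by (simp add: Suc_diff_le algebra_simps)
  finally show ?case .
qed simp

lemma const_le_exp_T:
  assumes "c > 0"
  obtains C where "C \<ge> 0" "\<And>m. c \<le> exp (C * T m)"
proof (rule that[of "max 0 (ln c) / \<Psi> 0"])
  show "0 \<le> max 0 (ln c) / \<Psi> 0" using Psi_pos[of 0] by simp
  fix m
  have "ln c \<le> max 0 (ln c) / \<Psi> 0 * \<Psi> 0" using Psi_pos[of 0] by simp
  also have "\<dots> \<le> max 0 (ln c) / \<Psi> 0 * T m"
    using Psi_pos[of 0] by (intro mult_left_mono T_ge_Psi0) simp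
  finally show "c \<le> exp (max 0 (ln c) / \<Psi> 0 * T m)" using assms by (metis exp_le_cancel_iff exp_ln)
qed

lemma power_le_exp_T:
  obtains C where "C \<ge> 0" "\<And>m. 2 ^ (r * Suc m) \<le> exp (C * T m)"
proof (rule that[of "real r / \<Psi> 0"])
  show "0 \<le> real r / \<Psi> 0" using Psi_pos[of 0] by simp
  fix m
  have "(2::real) ^ (r * Suc m) \<le> exp 1 ^ (r * Suc m)"
    by (rule power_mono) (use exp_ge_add_one_self[of 1] in auto)
  also have "\<dots> = exp (real r * real (Suc m))" by (simp add: exp_of_nat_mult[symmetric] algebra_simps)
  also have "real r * real (Suc m) = real r / \<Psi> 0 * (real (Suc m) * \<Psi> 0)" using Psi_pos[of 0] by (simp add: field_simps)
  also have "\<dots> \<le> real r / \<Psi> 0 * T m" using Psi_pos[of 0] by (intro mult_left_mono T_ge_linear) simp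
  finally show "2 ^ (r * Suc m) \<le> exp (real r / \<Psi> 0 * T m)" by simp
qed

definition moderate :: "(complex \<Rightarrow> complex) \<Rightarrow> bool" where
  "moderate f \<longleftrightarrow> f holomorphic_on ball 0 1 \<and>
     (\<exists>C\<ge>0. \<forall>w\<in>ball 0 1. norm (f w) \<le> exp (C * T (lev w)))"

lemma moderateI:
  assumes "f holomorphic_on ball 0 1" "C \<ge> 0" "\<And>w. w \<in> ball 0 1 \<Longrightarrow> norm (f w) \<le> exp (C * T (lev w))"
  shows "moderate f"
  using assms unfolding moderate_def by blast

lemma moderateE:
  assumes "moderate f"
  obtains C where "f holomorphic_on ball 0 1" "C \<ge> 0"
    "\<And>w. w \<in> ball 0 1 \<Longrightarrow> norm (f w) \<le> exp (C * T (lev w))"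
  using assms unfolding moderate_def by blast

lemma moderate_boundE:
  assumes "moderate f"
  obtains C where "C \<ge> 0" "\<And>w. w \<in> ball 0 1 \<Longrightarrow> norm (f w) \<le> exp (C * T (lev w))"
  using assms unfolding moderate_def by blast

lemma moderate_holomorphic: "moderate f \<Longrightarrow> f holomorphic_on ball 0 1"
  by (simp add: moderate_def)

lemma moderate_const: "moderate (\<lambda>_. c)"
proof -
  obtain C where C: "C \<ge> 0" "\<And>m. max 1 (norm c) \<le> exp (C * T m)"
    using const_le_exp_T[of "max 1 (norm c)"] by (metis less_max_iff_disj zero_less_one)
  show ?thesis by (rule moderateI[OF _ C(1)]) (use C(2) in \<open>auto dest: order_trans[OF max.cobounded2]\<close>)
qed

lemma moderate_mult:
  assumes "moderate f" "moderate g" shows "moderate (\<lambda>w. f w * g w)"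
proof -
  obtain C where C: "f holomorphic_on ball 0 1" "C \<ge> 0"
    "\<And>w. w \<in> ball 0 1 \<Longrightarrow> norm (f w) \<le> exp (C * T (lev w))"
    using moderateE[OF assms(1)] by blast
  obtain D where D: "g holomorphic_on ball 0 1" "D \<ge> 0"
    "\<And>w. w \<in> ball 0 1 \<Longrightarrow> norm (g w) \<le> exp (D * T (lev w))"
    using moderateE[OF assms(2)] by blast
  show ?thesis
  proof (rule moderateI[of _ "C + D"])
    fix w :: complex assume w: "w \<in> ball 0 1"
    have "norm (f w * g w) \<le> exp (C * T (lev w)) * exp (D * T (lev w))"
      unfolding norm_mult by (intro mult_mono C D w) auto
    thus "norm (f w * g w) \<le> exp ((C + D) * T (lev w))" by (simp add: exp_add algebra_simps)
  qed (use C D in \<open>auto intro!: holomorphic_intros\<close>)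
qed

lemma moderate_add:
  assumes "moderate f" "moderate g" shows "moderate (\<lambda>w. f w + g w)"
proof -
  obtain C where C: "f holomorphic_on ball 0 1" "C \<ge> 0"
    "\<And>w. w \<in> ball 0 1 \<Longrightarrow> norm (f w) \<le> exp (C * T (lev w))"
    using moderateE[OF assms(1)] by blast
  obtain D where D: "g holomorphic_on ball 0 1" "D \<ge> 0"
    "\<And>w. w \<in> ball 0 1 \<Longrightarrow> norm (g w) \<le> exp (D * T (lev w))"
    using moderateE[OF assms(2)] by blast
  obtain B where B: "B \<ge> 0" "\<And>m. 2 \<le> exp (B * T m)" using const_le_exp_T[of 2] by auto
  show ?thesis
  proof (rule moderateI[of _ "B + (C + D)"])
    fix w :: complex assume w: "w \<in> ball 0 1"
    have "C * T (lev w) \<ge> 0" "D * T (lev w) \<ge> 0" using C(2) D(2) T_pos[of "lev w"] by auto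
    hence "norm (f w) \<le> exp ((C + D) * T (lev w))" "norm (g w) \<le> exp ((C + D) * T (lev w))"
      using order_trans[OF C(3)[OF w], of "exp ((C + D) * T (lev w))"]
        order_trans[OF D(3)[OF w], of "exp ((C + D) * T (lev w))"] by (auto simp: algebra_simps)
    hence "norm (f w + g w) \<le> 2 * exp ((C + D) * T (lev w))" using norm_triangle_ineq[of "f w" "g w"] by linarith
    also have "\<dots> \<le> exp (B * T (lev w)) * exp ((C + D) * T (lev w))"
      by (rule mult_right_mono[OF B(2)]) simp
    also have "\<dots> = exp ((B + (C + D)) * T (lev w))" by (simp add: exp_add algebra_simps)
    finally show "norm (f w + g w) \<le> exp ((B + (C + D)) * T (lev w))" .
  qed (use B C D in \<open>auto intro!: holomorphic_intros\<close>)
qed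

text \<open>Cauchy's estimate on the circle of radius \<open>(1 - |w|) / 2\<close> about \<open>w\<close>: the level increases by at most one
  there, and dividing by the radius costs a factor \<open>2 ^ (lev w + 2)\<close>, which is itself within the scale
  because \<open>T m\<close> grows at least linearly in \<open>m\<close>.\<close>

lemma moderate_deriv:
  assumes "moderate f" shows "moderate (deriv f)"
proof -
  obtain C where C: "f holomorphic_on ball 0 1" "C \<ge> 0"
    "\<And>w. w \<in> ball 0 1 \<Longrightarrow> norm (f w) \<le> exp (C * T (lev w))"
    using moderateE[OF assms] by blast
  obtain B where B: "B \<ge> 0" "\<And>m. 2 ^ (2 * Suc m) \<le> exp (B * T m)" using power_le_exp_T[of 2] by auto
  show ?thesis
  proof (rule moderateI[of _ "B + C * (1 + 2 ^ s)"])
    fix w :: complex assume w: "w \<in> ball 0 1"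
    define r where "r = (1 - norm w) / 2"
    have r: "r > 0" using w by (simp add: r_def)
    have sub: "cball w r \<subseteq> ball 0 1"
    proof
      fix v assume "v \<in> cball w r"
      hence "norm v \<le> norm w + r" using norm_triangle_ineq[of w "v - w"] by (simp add: dist_norm norm_minus_commute)
      moreover have "norm w < 1" using w by simp
      ultimately have "norm v < 1" unfolding r_def by (simp add: field_simps)
      thus "v \<in> ball 0 1" by simp
    qed
    have bd: "norm (f v) \<le> exp (C * ((1 + 2 ^ s) * T (lev w)))" if "norm (w - v) = r" for v
    proof -
      have v: "v \<in> ball 0 1" using sub that by (auto simp: dist_norm)
      have "norm v \<le> norm w + r" using that norm_triangle_ineq[of w "v - w"] by (simp add: norm_minus_commute)
      hence "lev v \<le> lev w + 1" by (intro lev_mono v w) (simp add: r_def field_simps)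
      hence "T (lev v) \<le> (1 + 2 ^ s) * T (lev w)"
        using T_mono[of "lev v" "lev w + 1"] T_shift[of "lev w" 1] by simp
      hence "C * T (lev v) \<le> C * ((1 + 2 ^ s) * T (lev w))" by (rule mult_left_mono) (rule C)
      with C(3)[OF v] show ?thesis by (simp add: order_trans)
    qed
    have "norm ((deriv ^^ 1) f w) \<le> fact 1 * exp (C * ((1 + 2 ^ s) * T (lev w))) / r ^ 1"
    proof (rule Cauchy_inequality)
      show "f holomorphic_on ball w r"
        using holomorphic_on_subset[OF C(1)] sub ball_subset_cball by blast
      show "continuous_on (cball w r) f"
        using continuous_on_subset[OF holomorphic_on_imp_continuous_on[OF C(1)] sub] .
    qed (use r bd in auto)
    hence "norm (deriv f w) \<le> exp (C * ((1 + 2 ^ s) * T (lev w))) * (1 / r)" by simp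
    also have "\<dots> \<le> exp (C * ((1 + 2 ^ s) * T (lev w))) * exp (B * T (lev w))"
    proof (rule mult_left_mono)
      have "1 < 2 ^ Suc (lev w) * (2 * r)" using lev_gt[OF w] by (simp add: r_def algebra_simps)
      hence "1 / r \<le> 2 ^ (Suc (Suc (lev w)))" using r by (simp add: divide_simps mult_ac)
      also have "\<dots> \<le> 2 ^ (2 * Suc (lev w))" by (rule power_increasing) auto
      also have "\<dots> \<le> exp (B * T (lev w))" by (rule B)
      finally show "1 / r \<le> exp (B * T (lev w))" .
    qed simp
    also have "\<dots> = exp ((B + C * (1 + 2 ^ s)) * T (lev w))" by (simp add: exp_add algebra_simps)
    finally show "norm (deriv f w) \<le> exp ((B + C * (1 + 2 ^ s)) * T (lev w))" .
  qed (use B C in \<open>auto intro!: holomorphic_deriv add_nonneg_nonneg mult_nonneg_nonneg\<close>)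
qed

lemma moderate_cmult: "moderate f \<Longrightarrow> moderate (\<lambda>w. c * f w)"
  by (rule moderate_mult[OF moderate_const])

lemma moderate_minus: "moderate f \<Longrightarrow> moderate (\<lambda>w. - f w)"
  using moderate_cmult[of f "-1"] by simp

lemma moderate_suminf:
  assumes hol: "\<And>k. t k holomorphic_on ball 0 1" and C: "C \<ge> 0"
    and bound: "\<And>k w. w \<in> ball 0 1 \<Longrightarrow> norm (t k w) \<le> exp (C * T (lev w)) * a k"
    and a: "summable a" "\<And>k. a k \<ge> 0"
  shows "moderate (\<lambda>w. \<Sum>k. t k w)"
proof -
  obtain B where B: "B \<ge> 0" "\<And>m. 1 + suminf a \<le> exp (B * T m)"
    using const_le_exp_T[of "1 + suminf a"] suminf_nonneg[OF a] by auto
  show ?thesis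
  proof (rule moderateI[of _ "C + B"])
    show "(\<lambda>w. \<Sum>k. t k w) holomorphic_on ball 0 1"
    proof (rule holomorphic_uniform_sequence)
      fix w :: complex assume w: "w \<in> ball 0 1"
      define r where "r = (1 + norm w) / 2"
      have r: "norm w < r" "r < 1" "r > 0" using w by (auto simp: r_def intro: add_pos_nonneg)
      have "uniform_limit (cball 0 r) (\<lambda>n v. \<Sum>k<n. t k v) (\<lambda>v. \<Sum>k. t k v) sequentially"
      proof (rule Weierstrass_m_test)
        fix k v assume v: "v \<in> cball (0::complex) r"
        have v1: "v \<in> ball 0 1" using v r by auto
        have "lev v \<le> lev (of_real r) + 0" by (rule lev_mono) (use v r in auto)
        hence "C * T (lev v) \<le> C * T (lev (of_real r))" by (intro mult_left_mono T_mono C) simp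
        hence "exp (C * T (lev v)) * a k \<le> exp (C * T (lev (of_real r))) * a k"
          by (intro mult_right_mono a) simp
        with bound[OF v1] show "norm (t k v) \<le> exp (C * T (lev (of_real r))) * a k" by (rule order_trans)
      next
        show "summable (\<lambda>k. exp (C * T (lev (of_real r))) * a k)" by (rule summable_mult[OF a(1)])
      qed
      moreover have "cball w (r - norm w) \<subseteq> cball 0 r" by (simp add: cball_subset_cball_iff)
      ultimately show "\<exists>e>0. cball w e \<subseteq> ball 0 1 \<and>
          uniform_limit (cball w e) (\<lambda>n v. \<Sum>k<n. t k v) (\<lambda>v. \<Sum>k. t k v) sequentially"
        using r uniform_limit_on_subset by (intro exI[of _ "r - norm w"]) auto
    qed (auto intro!: holomorphic_intros hol)
    fix w :: complex assume w: "w \<in> ball 0 1"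
    have sm: "summable (\<lambda>k. exp (C * T (lev w)) * a k)" by (rule summable_mult[OF a(1)])
    have "norm (\<Sum>k. t k w) \<le> (\<Sum>k. exp (C * T (lev w)) * a k)"
      by (rule norm_suminf_le[OF bound[OF w] sm])
    also have "\<dots> = exp (C * T (lev w)) * suminf a" by (rule suminf_mult[OF a(1)])
    also have "\<dots> \<le> exp (C * T (lev w)) * exp (B * T (lev w))"
      using B(2)[of "lev w"] by (intro mult_left_mono) auto
    finally show "norm (\<Sum>k. t k w) \<le> exp ((C + B) * T (lev w))" by (simp add: exp_add distrib_right)
  qed (use B C in auto)
qed

end

section \<open>Packing of the zeros\<close>

text \<open>
  The assumption \<open>separated\<close> is the hypothesis on the integrated counting function with the integral carried out,
  restricted to finite sets of indices.
\<close>

locale zero_sequence = growth_scale \<Psi> s for \<Psi> :: "nat \<Rightarrow> real" and s :: nat +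
  fixes z :: "nat \<Rightarrow> complex" and C1 :: real
  assumes z_in: "\<And>n. z n \<in> ball 0 1"
    and z_inj: "inj z"
    and C1_nonneg: "C1 \<ge> 0"
    and separated: "\<And>k I. finite I \<Longrightarrow> k \<notin> I \<Longrightarrow>
       (\<And>n. n \<in> I \<Longrightarrow> norm (z n - z k) \<le> (1 - norm (z k)) / 2) \<Longrightarrow>
       (\<Sum>n\<in>I. ln ((1 - norm (z k)) / (2 * norm (z n - z k)))) \<le> C1 * \<Psi> (lev (z k))"
begin

definition d :: "nat \<Rightarrow> real" where "d n = 1 - norm (z n)"

lemma d_pos: "d n > 0" and d_le_1: "d n \<le> 1"
  using z_in[of n] by (auto simp: d_def)

lemma z_neq: "n \<noteq> k \<Longrightarrow> z n \<noteq> z k"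
  using z_inj by (auto simp: inj_def)

lemma d_lev: "1 < 2 ^ Suc (lev (z n)) * d n" "2 ^ lev (z n) * d n \<le> 1"
  using lev_gt[OF z_in] lev_le[OF z_in] by (auto simp: d_def)

lemma card_near_le:
  assumes "finite I" "k \<notin> I" "\<And>n. n \<in> I \<Longrightarrow> norm (z n - z k) \<le> d k / 4"
  shows "real (card I) * ln 2 \<le> C1 * \<Psi> (lev (z k))"
proof -
  have "real (card I) * ln 2 = (\<Sum>n\<in>I. ln 2)" by simp
  also have "\<dots> \<le> (\<Sum>n\<in>I. ln ((1 - norm (z k)) / (2 * norm (z n - z k))))"
  proof (rule sum_mono)
    fix n assume n: "n \<in> I"
    hence "n \<noteq> k" using assms by auto
    hence p: "norm (z n - z k) > 0" using z_neq by simp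
    have "2 \<le> (1 - norm (z k)) / (2 * norm (z n - z k))"
      using assms(3)[OF n] p by (simp add: d_def field_simps)
    thus "ln 2 \<le> ln ((1 - norm (z k)) / (2 * norm (z n - z k)))" by simp
  qed
  also have "\<dots> \<le> C1 * \<Psi> (lev (z k))"
  proof (rule separated)
    fix n assume "n \<in> I"
    from assms(3)[OF this] show "norm (z n - z k) \<le> (1 - norm (z k)) / 2"
      using d_pos[of k] by (simp add: d_def)
  qed (use assms in auto)
  finally show ?thesis .
qed

text \<open>The plane is cut into squares of side \<open>2^(-j-4)\<close>. Two zeros of level \<open>j\<close> in the same square are within a
  quarter of the distance to the circle from each other, so each square carries \<open>O(\<Psi> j)\<close> zeros. The weight
  is dominated by a product of two one-dimensional weights with exponent \<open>2\<close>, and so its sum over all squares of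
  the plane is bounded uniformly in \<open>w\<close>.\<close>

lemma annulus_packing:
  obtains C where "C \<ge> 0"
    "\<And>I j w. finite I \<Longrightarrow> (\<And>n. n \<in> I \<Longrightarrow> lev (z n) = j) \<Longrightarrow>
       (\<Sum>n\<in>I. 1 / (1 + 2 ^ j * norm (z n - w)) ^ 4) \<le> C * \<Psi> j"
proof -
  define K where "K = 1 / \<Psi> 0 + C1 / ln 2"
  have K0: "K \<ge> 0" unfolding K_def using C1_nonneg Psi_pos[of 0] by simp
  define C where "C = K * (16 ^ 4 * 81)"
  have main: "(\<Sum>n\<in>I. 1 / (1 + 2 ^ j * norm (z n - w)) ^ 4) \<le> C * \<Psi> j"
    if I: "finite I" and lev: "\<And>n. n \<in> I \<Longrightarrow> lev (z n) = j" for I j w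
  proof -
    define M :: real where "M = 2 ^ (j + 4)"
    have M: "M > 0" "M = 16 * 2 ^ j" by (auto simp: M_def power_add)
    define cx where "cx n = \<lfloor>M * Re (z n)\<rfloor>" for n
    define cy where "cy n = \<lfloor>M * Im (z n)\<rfloor>" for n
    define c where "c n = (cx n, cy n)" for n
    define f where "f n = 1 / (1 + 2 ^ j * norm (z n - w)) ^ 4" for n
    define G where "G x a = 1 / (1 + \<bar>real_of_int a - x\<bar>)\<^sup>2" for x :: real and a :: int
    have G0: "G x a \<ge> 0" for x a by (simp add: G_def)
    have f_le: "f n \<le> 16 ^ 4 * (G (M * Re w) (cx n) * G (M * Im w) (cy n))" for n
    proof -
      define D where "D = 1 + 2 ^ j * norm (z n - w)"
      have D: "D \<ge> 1" by (simp add: D_def)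
      have aux: "1 + \<bar>real_of_int \<lfloor>M * a\<rfloor> - M * b\<bar> \<le> 16 * D" if "\<bar>a - b\<bar> \<le> norm (z n - w)" for a b
      proof -
        have "\<bar>real_of_int \<lfloor>M * a\<rfloor> - M * b\<bar> \<le> 1 + \<bar>M * a - M * b\<bar>" by linarith
        also have "\<bar>M * a - M * b\<bar> = M * \<bar>a - b\<bar>" using M(1) by (simp add: abs_mult flip: right_diff_distrib)
        also have "\<dots> \<le> M * norm (z n - w)" using that M(1) by (intro mult_left_mono) auto
        finally have "1 + \<bar>real_of_int \<lfloor>M * a\<rfloor> - M * b\<bar> \<le> 2 + 16 * (2 ^ j * norm (z n - w))"
          unfolding M(2) by simp
        thus ?thesis unfolding D_def by simp
      qed
      have X: "1 + \<bar>real_of_int (cx n) - M * Re w\<bar> \<le> 16 * D" unfolding cx_def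
        by (rule aux) (use abs_Re_le_cmod[of "z n - w"] in simp)
      have Y: "1 + \<bar>real_of_int (cy n) - M * Im w\<bar> \<le> 16 * D" unfolding cy_def
        by (rule aux) (use abs_Im_le_cmod[of "z n - w"] in simp)
      have "1 / (16 * D)\<^sup>2 \<le> G (M * Re w) (cx n)" unfolding G_def
        by (intro divide_left_mono power_mono X mult_pos_pos zero_less_power) (use D in auto)
      moreover have "1 / (16 * D)\<^sup>2 \<le> G (M * Im w) (cy n)" unfolding G_def
        by (intro divide_left_mono power_mono Y mult_pos_pos zero_less_power) (use D in auto)
      ultimately have "1 / (16 * D)\<^sup>2 * (1 / (16 * D)\<^sup>2) \<le> G (M * Re w) (cx n) * G (M * Im w) (cy n)"
        by (intro mult_mono G0) auto
      moreover have "f n = 16 ^ 4 * (1 / (16 * D)\<^sup>2 * (1 / (16 * D)\<^sup>2))"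
        using D by (simp add: f_def D_def[symmetric] power_mult_distrib divide_simps flip: power_add)
      ultimately show ?thesis by simp
    qed
    have count: "real (card {n\<in>I. c n = p}) \<le> K * \<Psi> j" for p
    proof (cases "{n\<in>I. c n = p} = {}")
      case True
      show ?thesis unfolding True using K0 Psi_pos[of j] by simp
    next
      case False
      then obtain k where k: "k \<in> I" "c k = p" by auto
      let ?S = "{n\<in>I. c n = p}"
      have "real (card (?S - {k})) * ln 2 \<le> C1 * \<Psi> (lev (z k))"
      proof (rule card_near_le)
        fix n assume "n \<in> ?S - {k}"
        hence "c n = c k" using k by simp
        hence "cx n = cx k" "cy n = cy k" by (auto simp: c_def)
        hence "\<bar>M * Re (z n) - M * Re (z k)\<bar> \<le> 1" "\<bar>M * Im (z n) - M * Im (z k)\<bar> \<le> 1"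
          unfolding cx_def cy_def by linarith+
        hence "\<bar>M * Re (z n - z k)\<bar> \<le> 1" "\<bar>M * Im (z n - z k)\<bar> \<le> 1" by (auto simp: algebra_simps)
        hence "M * \<bar>Re (z n - z k)\<bar> \<le> 1" "M * \<bar>Im (z n - z k)\<bar> \<le> 1" using M by (auto simp: abs_mult)
        hence "M * norm (z n - z k) \<le> 2"
          using mult_left_mono[OF cmod_le[of "z n - z k"], of M] M(1) by (simp add: distrib_left)
        moreover have "M * (d k / 4) \<ge> 2" using d_lev(1)[of k] unfolding lev[OF k(1)] M(2) by (simp only: power_Suc)
        ultimately have "M * norm (z n - z k) \<le> M * (d k / 4)" by linarith
        thus "norm (z n - z k) \<le> d k / 4" using M(1) by simp
      qed (use I in auto)
      hence "real (card (?S - {k})) \<le> C1 / ln 2 * \<Psi> j" using lev[OF k(1)] by (simp add: field_simps)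
      moreover have "real (card ?S) = real (card (?S - {k})) + 1"
        using I k by (subst card.remove[of ?S k]) auto
      moreover have "1 \<le> 1 / \<Psi> 0 * \<Psi> j" using Psi_mono[of 0 j] Psi_pos[of 0] by simp
      ultimately show ?thesis unfolding K_def by (simp add: distrib_right)
    qed
    have "(\<Sum>n\<in>I. f n) \<le> (\<Sum>n\<in>I. 16 ^ 4 * (G (M * Re w) (fst (c n)) * G (M * Im w) (snd (c n))))"
      by (intro sum_mono) (use f_le in \<open>simp add: c_def\<close>)
    also have "\<dots> = (\<Sum>p\<in>c ` I. \<Sum>n\<in>{n\<in>I. c n = p}. 16 ^ 4 * (G (M * Re w) (fst (c n)) * G (M * Im w) (snd (c n))))"
      by (rule sum.image_gen[OF I])
    also have "\<dots> = (\<Sum>p\<in>c ` I. real (card {n\<in>I. c n = p}) * (16 ^ 4 * (G (M * Re w) (fst p) * G (M * Im w) (snd p))))"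
      by (intro sum.cong refl) simp
    also have "\<dots> \<le> (\<Sum>p\<in>c ` I. K * \<Psi> j * (16 ^ 4 * (G (M * Re w) (fst p) * G (M * Im w) (snd p))))"
      by (intro sum_mono mult_right_mono count) (auto intro!: mult_nonneg_nonneg G0)
    also have "\<dots> \<le> (\<Sum>p\<in>cx ` I \<times> cy ` I. K * \<Psi> j * (16 ^ 4 * (G (M * Re w) (fst p) * G (M * Im w) (snd p))))"
      by (intro sum_mono2) (use I K0 Psi_pos[of j] in \<open>auto simp: c_def intro!: mult_nonneg_nonneg G0\<close>)
    also have "\<dots> = K * \<Psi> j * 16 ^ 4 * ((\<Sum>a\<in>cx ` I. G (M * Re w) a) * (\<Sum>b\<in>cy ` I. G (M * Im w) b))"
    proof -
      have "(\<Sum>a\<in>cx ` I. G (M * Re w) a) * (\<Sum>b\<in>cy ` I. G (M * Im w) b)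
          = (\<Sum>p\<in>cx ` I \<times> cy ` I. G (M * Re w) (fst p) * G (M * Im w) (snd p))"
        by (simp only: sum_product sum.cartesian_product case_prod_unfold)
      thus ?thesis by (simp only: sum_distrib_left mult.assoc)
    qed
    also have "\<dots> \<le> K * \<Psi> j * 16 ^ 4 * (9 * 9)"
      unfolding G_def using I K0 Psi_pos[of j]
      by (intro mult_left_mono mult_mono sum_inverse_square_int_le sum_nonneg) auto
    also have "\<dots> = C * \<Psi> j" by (simp add: C_def)
    finally show ?thesis by (simp add: f_def)
  qed
  show ?thesis by (rule that[of C]) (use main K0 in \<open>auto simp: C_def\<close>)
qed

text \<open>
  The point \<open>\<zeta> n\<close> is the mirror image of \<open>z n\<close> in the tangent to the unit circle at the nearest point
  \<open>dir n\<close>. It is the pole of the argument \<open>A n\<close> of the \<open>n\<close>-th elementary factor. Keeping it at distance \<open>d n\<close> from the disc makes \<open>A n\<close>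
  bounded in the disc, and \<open>A n\<close> decays away from \<open>z n\<close> on the scale \<open>d n\<close>. Unlike \<open>1 / cnj (z n)\<close>, this
  choice makes sense for \<open>z n = 0\<close> as well, where the direction is arbitrary.
\<close>

definition dir :: "nat \<Rightarrow> complex" where "dir n = (if z n = 0 then 1 else sgn (z n))"
definition \<zeta> :: "nat \<Rightarrow> complex" where "\<zeta> n = z n + of_real (2 * d n) * dir n"
definition q :: "nat \<Rightarrow> complex \<Rightarrow> real" where "q n w = d n / norm (\<zeta> n - w)"
definition A :: "nat \<Rightarrow> complex \<Rightarrow> complex" where "A n w = (\<zeta> n - z n) / (\<zeta> n - w)"

lemma norm_dir [simp]: "norm (dir n) = 1" by (simp add: dir_def norm_sgn)

lemma norm_zeta_minus_z: "norm (\<zeta> n - z n) = 2 * d n"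
  using d_pos[of n] by (simp add: \<zeta>_def norm_mult)

lemma norm_zeta: "norm (\<zeta> n) = 1 + d n"
proof -
  have "z n = of_real (norm (z n)) * dir n" by (simp add: dir_def sgn_eq)
  hence "\<zeta> n = of_real (norm (z n) + 2 * d n) * dir n" unfolding \<zeta>_def by (simp add: algebra_simps)
  hence "norm (\<zeta> n) = \<bar>norm (z n) + 2 * d n\<bar>" by (simp only: norm_mult norm_of_real norm_dir mult_1_right)
  thus ?thesis using d_pos[of n] by (simp add: d_def)
qed

lemma zeta_dist_ge: "d n + (1 - norm w) \<le> norm (\<zeta> n - w)"
  using norm_triangle_ineq2[of "\<zeta> n" w] norm_zeta[of n] by simp

lemma zeta_neq: "w \<in> ball 0 1 \<Longrightarrow> \<zeta> n - w \<noteq> 0"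
  using zeta_dist_ge[of n w] d_pos[of n] by auto

lemma zeta_dist_pos: "w \<in> ball 0 1 \<Longrightarrow> norm (\<zeta> n - w) > 0"
  using zeta_neq by simp

lemma norm_A: "norm (A n w) = 2 * q n w"
  by (simp add: A_def q_def norm_divide norm_zeta_minus_z)

lemma one_minus_A: "w \<in> ball 0 1 \<Longrightarrow> 1 - A n w = (z n - w) / (\<zeta> n - w)"
  using zeta_neq[of w n] by (simp add: A_def divide_simps)

lemma q_nonneg: "q n w \<ge> 0" using d_pos[of n] by (simp add: q_def)

lemma q_le_1: assumes "w \<in> ball 0 1" shows "q n w \<le> 1"
  using zeta_dist_ge[of n w] d_pos[of n] zeta_dist_pos[OF assms, of n] assms by (simp add: q_def divide_simps)

lemma q_le_radial: assumes "w \<in> ball 0 1" shows "q n w \<le> d n / (1 - norm w)"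
  unfolding q_def using zeta_dist_ge[of n w] d_pos[of n] zeta_dist_pos[OF assms, of n] assms
  by (intro divide_left_mono) auto

lemma q_le_dist: assumes "w \<in> ball 0 1" shows "q n w \<le> 4 / (1 + 2 ^ lev (z n) * norm (z n - w))"
proof -
  have "norm (z n - w) \<le> norm (\<zeta> n - w) + 2 * d n"
    using norm_triangle_ineq4[of "\<zeta> n - w" "\<zeta> n - z n"] norm_zeta_minus_z[of n] by simp
  moreover have "d n \<le> norm (\<zeta> n - w)" using zeta_dist_ge[of n w] assms by simp
  ultimately have le: "d n + norm (z n - w) \<le> 4 * norm (\<zeta> n - w)" by linarith
  have "q n w * (1 + 2 ^ lev (z n) * norm (z n - w)) = q n w + (2 ^ lev (z n) * d n) * norm (z n - w) / norm (\<zeta> n - w)"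
    by (simp add: q_def distrib_left)
  also have "\<dots> \<le> q n w + 1 * norm (z n - w) / norm (\<zeta> n - w)"
    using d_lev(2)[of n] by (intro add_left_mono divide_right_mono mult_right_mono) auto
  also have "\<dots> = (d n + norm (z n - w)) / norm (\<zeta> n - w)" by (simp add: q_def add_divide_distrib)
  also have "\<dots> \<le> 4" using le zeta_dist_pos[OF assms, of n] by (simp add: divide_simps)
  finally show ?thesis by (simp add: field_simps add_pos_nonneg)
qed

text \<open>Let \<open>m = lev w\<close>. Four of the \<open>s + 5\<close> powers of \<open>q n w\<close> are spent on \<open>annulus_packing\<close>, which yields
  \<open>O(\<Psi> j)\<close> for the zeros of level \<open>j\<close>; for \<open>j \<le> m\<close> these contributions add up to \<open>T m\<close>. For \<open>j > m\<close>
  the other \<open>s + 1\<close> powers give, up to a constant, the factor \<open>2^((m - j) (s + 1))\<close>, which beats the growth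
  \<open>\<Psi> j \<le> 2^((j - m) s) \<Psi> m\<close>.\<close>

lemma sum_q_le:
  obtains C where "C \<ge> 0"
    "\<And>I w. finite I \<Longrightarrow> w \<in> ball 0 1 \<Longrightarrow> (\<Sum>n\<in>I. q n w ^ (s + 5)) \<le> C * T (lev w)"
proof -
  obtain B where B: "B \<ge> 0"
    "\<And>I j w. finite I \<Longrightarrow> (\<And>n. n \<in> I \<Longrightarrow> lev (z n) = j) \<Longrightarrow>
       (\<Sum>n\<in>I. 1 / (1 + 2 ^ j * norm (z n - w)) ^ 4) \<le> B * \<Psi> j"
    using annulus_packing by blast
  define C where "C = 256 * B * (1 + 2 ^ (s + 1) * 2)"
  have main: "(\<Sum>n\<in>I. q n w ^ (s + 5)) \<le> C * T (lev w)" if I: "finite I" and w: "w \<in> ball 0 1" for I w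
  proof -
    define m where "m = lev w"
    \<comment> \<open>the gain from the zeros that are closer to the circle than \<open>w\<close>\<close>
    define t where "t j = (if j \<le> m then 1 else (2 * (1/2) ^ (j - m)) ^ (s + 1) :: real)" for j
    have t0: "t j \<ge> 0" for j by (simp add: t_def)
    have q4: "q n w ^ 4 \<le> 256 * (1 / (1 + 2 ^ lev (z n) * norm (z n - w)) ^ 4)" for n
      using power_mono[OF q_le_dist[OF w, of n] q_nonneg, of 4] by (simp add: power_divide)
    have qs: "q n w ^ (s + 1) \<le> t (lev (z n))" for n
    proof (cases "lev (z n) \<le> m")
      case True
      thus ?thesis using power_le_one[OF q_nonneg q_le_1[OF w], of n "s + 1"] by (simp add: t_def)
    next
      case False
      define j where "j = lev (z n)"
      have jm: "j = m + (j - m)" using False by (simp add: j_def)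
      have "q n w \<le> d n / (1 - norm w)" by (rule q_le_radial[OF w])
      also have "\<dots> \<le> 2 * (1/2) ^ (j - m)"
      proof -
        have "d n * 2 ^ j \<le> 1" using d_lev(2)[of n] by (simp add: j_def mult.commute)
        also have "1 \<le> 2 ^ Suc m * (1 - norm w)" using lev_gt[OF w] by (simp add: m_def)
        finally have "d n * 2 ^ (j - m) * 2 ^ m \<le> 2 * (1 - norm w) * 2 ^ m"
          by (subst (asm) jm) (simp add: power_add mult_ac)
        hence "d n * 2 ^ (j - m) \<le> 2 * (1 - norm w)" by simp
        thus ?thesis using w by (simp add: divide_simps power_one_over mult_ac)
      qed
      finally have "q n w ^ (s + 1) \<le> (2 * (1/2) ^ (j - m)) ^ (s + 1)" by (rule power_mono) (rule q_nonneg)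
      thus ?thesis using False by (simp add: t_def j_def)
    qed
    have bnd: "q n w ^ (s + 5) \<le> 256 * (1 / (1 + 2 ^ lev (z n) * norm (z n - w)) ^ 4) * t (lev (z n))" for n
    proof -
      have "q n w ^ (s + 5) = q n w ^ 4 * q n w ^ (s + 1)" 
        unfolding power_add[symmetric] by (rule arg_cong[of _ _ "power (q n w)"]) simp
      also have "\<dots> \<le> 256 * (1 / (1 + 2 ^ lev (z n) * norm (z n - w)) ^ 4) * t (lev (z n))"
        by (rule mult_mono[OF q4 qs]) (auto intro!: mult_nonneg_nonneg zero_le_power q_nonneg)
      finally show ?thesis .
    qed
    obtain J where J: "(\<lambda>n. lev (z n)) ` I \<subseteq> {..m + J}"
    proof -
      obtain J where "\<And>j. j \<in> (\<lambda>n. lev (z n)) ` I \<Longrightarrow> j \<le> J"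
        using I by (meson finite_imageI finite_nat_set_iff_bounded_le)
      thus ?thesis by (intro that[of J]) fastforce
    qed
    have "(\<Sum>n\<in>I. q n w ^ (s + 5)) = (\<Sum>j\<in>{..m+J}. \<Sum>n\<in>{n\<in>I. lev (z n) = j}. q n w ^ (s + 5))"
      by (rule sum.group[symmetric]) (use I J in auto)
    also have "\<dots> \<le> (\<Sum>j\<in>{..m+J}. 256 * B * (t j * \<Psi> j))"
    proof (rule sum_mono)
      fix j
      have "(\<Sum>n\<in>{n\<in>I. lev (z n) = j}. q n w ^ (s + 5))
         \<le> (\<Sum>n\<in>{n\<in>I. lev (z n) = j}. 256 * t j * (1 / (1 + 2 ^ j * norm (z n - w)) ^ 4))"
        by (intro sum_mono) (use bnd in \<open>auto simp: mult_ac\<close>)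
      also have "\<dots> = 256 * t j * (\<Sum>n\<in>{n\<in>I. lev (z n) = j}. 1 / (1 + 2 ^ j * norm (z n - w)) ^ 4)"
        by (rule sum_distrib_left[symmetric])
      also have "\<dots> \<le> 256 * t j * (B * \<Psi> j)"
        by (intro mult_left_mono B(2)) (use I t0 in auto)
      finally show "(\<Sum>n\<in>{n\<in>I. lev (z n) = j}. q n w ^ (s + 5)) \<le> 256 * B * (t j * \<Psi> j)" by (simp add: mult_ac)
    qed
    also have "\<dots> = 256 * B * (\<Sum>j\<in>{..m+J}. t j * \<Psi> j)" by (rule sum_distrib_left[symmetric])
    also have "\<dots> \<le> 256 * B * ((1 + 2 ^ (s + 1) * 2) * T m)"
    proof (rule mult_left_mono)
      have "(\<Sum>j\<in>{..m+J}. t j * \<Psi> j) \<le> T m + 2 ^ (s + 1) * (2 - 2 * (1/2) ^ J) * \<Psi> m"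
      proof (induction J)
        case 0
        have "(\<Sum>j\<in>{..m}. t j * \<Psi> j) = T m" unfolding T_def by (rule sum.cong) (auto simp: t_def)
        thus ?case by simp
      next
        case (Suc J)
        have "t (m + Suc J) * \<Psi> (m + Suc J) \<le> t (m + Suc J) * (2 ^ (s * Suc J) * \<Psi> m)"
          by (intro mult_left_mono Psi_add_le t0)
        also have "t (m + Suc J) * (2 ^ (s * Suc J) * \<Psi> m) = 2 ^ (s + 1) * (1/2) ^ Suc J * \<Psi> m"
        proof -
          define x :: real where "x = (1/2) ^ Suc J"
          have x: "x > 0" by (simp add: x_def)
          have "t (m + Suc J) = (2 * x) ^ (s + 1)" unfolding t_def x_def by simp
          moreover have "(2::real) ^ (s * Suc J) = (1 / x) ^ s"
            by (simp only: x_def power_mult mult.commute[of s] power_one_over) simp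
          ultimately have "t (m + Suc J) * 2 ^ (s * Suc J) = 2 ^ (s + 1) * (x * (x ^ s * (1 / x) ^ s))"
            by (simp add: power_mult_distrib)
          also have "x ^ s * (1 / x) ^ s = 1" using x by (simp flip: power_mult_distrib)
          finally have "t (m + Suc J) * 2 ^ (s * Suc J) = 2 ^ (s + 1) * (1/2) ^ Suc J" by (simp only: x_def mult_1_right)
          thus ?thesis by (simp only: mult.assoc[symmetric])
        qed
        finally have "t (m + Suc J) * \<Psi> (m + Suc J) \<le> 2 ^ (s + 1) * (1/2) ^ Suc J * \<Psi> m" .
        moreover have "2 ^ (s + 1) * (1/2) ^ Suc J * \<Psi> m \<ge> 0" using Psi_pos[of m] by simp
        moreover have "2 ^ (s + 1) * (2 - 2 * (1/2) ^ J) * \<Psi> m + 2 * (2 ^ (s + 1) * (1/2) ^ Suc J * \<Psi> m)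
            = 2 ^ (s + 1) * (2 - 2 * (1/2) ^ Suc J) * \<Psi> m"
          by (simp add: algebra_simps)
        ultimately show ?case using Suc.IH by simp
      qed
      also have "\<dots> \<le> T m + 2 ^ (s + 1) * 2 * T m"
        using Psi_pos[of m] by (intro add_left_mono mult_mono T_ge_Psi mult_left_mono) auto
      finally show "(\<Sum>j\<in>{..m+J}. t j * \<Psi> j) \<le> (1 + 2 ^ (s + 1) * 2) * T m" by (simp add: algebra_simps)
    qed (use B in auto)
    finally show ?thesis by (simp add: C_def m_def mult_ac)
  qed
  show ?thesis by (rule that[of C]) (use main B in \<open>auto simp: C_def\<close>)
qed

text \<open>The case \<open>w = 0\<close> of \<open>sum_q_le\<close>, where \<open>q n 0\<close> is comparable with \<open>d n\<close>.\<close>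

lemma summable_d: "summable (\<lambda>n. d n ^ (s + 5))"
proof -
  obtain C where C: "\<And>I w. finite I \<Longrightarrow> w \<in> ball 0 1 \<Longrightarrow> (\<Sum>n\<in>I. q n w ^ (s + 5)) \<le> C * T (lev w)"
    using sum_q_le by blast
  have "summable (\<lambda>n. q n 0 ^ (s + 5))"
  proof (rule summableI_nonneg_bounded)
    show "0 \<le> q n 0 ^ (s + 5)" for n by (intro zero_le_power q_nonneg)
    show "(\<Sum>n<k. q n 0 ^ (s + 5)) \<le> C * T (lev 0)" for k by (rule C) auto
  qed
  hence "summable (\<lambda>n. 2 ^ (s + 5) * q n 0 ^ (s + 5))" by (rule summable_mult)
  thus ?thesis
  proof (rule summable_comparison_test'[of _ 0])
    fix n
    have "d n \<le> 2 * q n 0"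
      proof -
      have "d n * (1 + d n) \<le> d n * 2" using d_pos[of n] d_le_1[of n] by (intro mult_left_mono) auto
      thus ?thesis using d_pos[of n] by (simp add: q_def norm_zeta field_simps)
    qed
    hence "d n ^ (s + 5) \<le> (2 * q n 0) ^ (s + 5)" by (rule power_mono) (use d_pos[of n] in simp)
    thus "norm (d n ^ (s + 5)) \<le> 2 ^ (s + 5) * q n 0 ^ (s + 5)"
      using d_pos[of n] by (simp add: power_mult_distrib)
  qed
qed

section \<open>The canonical product\<close>

text \<open>The genus \<open>s + 4\<close> is chosen such that the deviation of the factor from \<open>1\<close> is of the order \<open>s + 5\<close> in
  \<open>q n\<close>, the exponent for which \<open>sum_q_le\<close> holds.\<close>

definition E :: "nat \<Rightarrow> complex \<Rightarrow> complex" where "E n w = weierstrass_factor (s + 4) (A n w)"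

text \<open>Products over arbitrary index sets are needed because single zeros and clusters of zeros are split off
  later on.\<close>

definition P :: "nat set \<Rightarrow> complex \<Rightarrow> complex" where
  "P N w = (\<Prod>n. if n \<in> N then E n w else 1)"

lemma A_holomorphic: "A n holomorphic_on ball 0 1"
proof -
  have "(\<lambda>w. (\<zeta> n - z n) / (\<zeta> n - w)) holomorphic_on ball 0 1"
    by (intro holomorphic_intros) (use zeta_neq in auto)
  thus ?thesis by (simp add: A_def[abs_def])
qed

lemma E_holomorphic: "E n holomorphic_on ball 0 1"
proof -
  have "(\<lambda>w. weierstrass_factor (s + 4) (A n w)) holomorphic_on ball 0 1"
    by (intro holomorphic_intros A_holomorphic)
  thus ?thesis by (simp add: E_def[abs_def])
qed

lemma A_at_z [simp]: "A n (z n) = 1"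
  using zeta_neq[OF z_in, of n n] by (simp add: A_def)

lemma E_eq_0_iff: assumes "w \<in> ball 0 1" shows "E n w = 0 \<longleftrightarrow> w = z n"
proof -
  have "E n w = 0 \<longleftrightarrow> 1 - A n w = 0" by (auto simp: E_def)
  also have "\<dots> \<longleftrightarrow> w = z n" unfolding one_minus_A[OF assms] using zeta_neq[OF assms, of n] by auto
  finally show ?thesis .
qed

lemma norm_A_le_2: "w \<in> ball 0 1 \<Longrightarrow> norm (A n w) \<le> 2"
  using q_le_1[of w n] by (simp add: norm_A)

lemma uniformly_convergent_factors:
  assumes "r < 1"
  shows "uniformly_convergent_on (cball 0 r) (\<lambda>k w. \<Sum>n<k. norm ((if n \<in> N then E n w else 1) - 1))"
proof (rule Weierstrass_m_test'_ev)
  define c where "c = 2 / (1 - r)"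
  have c: "c > 0" using assms by (simp add: c_def)
  have "(\<lambda>n. d n ^ (s + 5)) \<longlonglongrightarrow> 0" by (rule summable_LIMSEQ_zero[OF summable_d])
  hence "eventually (\<lambda>n. d n ^ (s + 5) < (1 / (2 * c)) ^ (s + 5)) sequentially"
    by (rule order_tendstoD) (use c in auto)
  thus "eventually (\<lambda>n. \<forall>w\<in>cball 0 r. norm (norm ((if n \<in> N then E n w else 1) - 1)) \<le> 3 * (c * d n) ^ (s + 5)) sequentially"
  proof eventually_elim
    case (elim n)
    hence dn: "d n < 1 / (2 * c)" by (rule power_less_imp_less_base) (use c in auto)
    show ?case
    proof
      fix w :: complex assume w: "w \<in> cball 0 r"
      hence w1: "w \<in> ball 0 1" using assms by auto
      have "norm (A n w) = 2 * q n w" by (rule norm_A)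
      also have "\<dots> \<le> 2 * (d n / (1 - norm w))" using mult_left_mono[OF q_le_radial[OF w1], of 2 n] by simp
      also have "\<dots> \<le> 2 * (d n / (1 - r))"
        using w assms d_pos[of n] by (intro mult_left_mono divide_left_mono) auto
      also have "\<dots> = c * d n" by (simp add: c_def)
      finally have A: "norm (A n w) \<le> c * d n" .
      also have "c * d n \<le> 1 / 2" using dn c by (simp add: field_simps)
      finally have "norm (E n w - 1) \<le> 3 * norm (A n w) ^ Suc (s + 4)"
        unfolding E_def by (rule weierstrass_factor_bound)
      also have "\<dots> \<le> 3 * (c * d n) ^ (s + 5)" 
        using power_mono[OF A norm_ge_zero, of "Suc (s + 4)"] by (simp add: add.commute)
      finally show "norm (norm ((if n \<in> N then E n w else 1) - 1)) \<le> 3 * (c * d n) ^ (s + 5)"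
        using c d_pos[of n] by simp
    qed
  qed
  have "summable (\<lambda>n. (3 * c ^ (s + 5)) * d n ^ (s + 5))" by (rule summable_mult[OF summable_d])
  thus "summable (\<lambda>n. 3 * (c * d n) ^ (s + 5))" by (simp add: power_mult_distrib mult.assoc)
qed

lemma convergent_P:
  assumes "w \<in> ball 0 1" shows "convergent_prod (\<lambda>n. if n \<in> N then E n w else 1)"
proof -
  have "uniformly_convergent_on (cball 0 (norm w)) (\<lambda>k w. \<Sum>n<k. norm ((if n \<in> N then E n w else 1) - 1))"
    by (rule uniformly_convergent_factors) (use assms in simp)
  hence "convergent (\<lambda>k. \<Sum>n<k. norm ((if n \<in> N then E n w else 1) - 1))"
    by (rule uniformly_convergent_imp_convergent) simp
  hence "summable (\<lambda>n. norm ((if n \<in> N then E n w else 1) - 1))" by (simp add: summable_iff_convergent)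
  thus ?thesis by (intro abs_convergent_prod_imp_convergent_prod) (simp add: abs_convergent_prod_conv_summable)
qed

lemma P_LIMSEQ:
  assumes "w \<in> ball 0 1" shows "(\<lambda>k. \<Prod>n\<in>{..<k} \<inter> N. E n w) \<longlonglongrightarrow> P N w"
proof -
  have "(\<lambda>k. \<Prod>n\<le>k. if n \<in> N then E n w else 1) \<longlonglongrightarrow> P N w"
    unfolding P_def by (rule convergent_prod_LIMSEQ[OF convergent_P[OF assms]])
  hence "(\<lambda>k. \<Prod>n<k. if n \<in> N then E n w else 1) \<longlonglongrightarrow> P N w"
    by (simp add: LIMSEQ_lessThan_iff_atMost)
  thus ?thesis by (simp add: prod.inter_restrict)
qed

lemma P_eq_0_iff:
  assumes "w \<in> ball 0 1" shows "P N w = 0 \<longleftrightarrow> w \<in> z ` N"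
proof -
  have "(\<lambda>n. if n \<in> N then E n w else 1) has_prod P N w"
    unfolding P_def using convergent_P[OF assms] by auto
  from has_prod_eq_0_iff[OF this] have "P N w = 0 \<longleftrightarrow> (\<exists>n. (if n \<in> N then E n w else 1) = 0)" by auto
  thus ?thesis using E_eq_0_iff[OF assms] by (auto split: if_splits)
qed

lemma P_holomorphic: "P N holomorphic_on ball 0 1"
proof (rule holomorphic_uniform_sequence)
  fix w :: complex assume w: "w \<in> ball 0 1"
  define r where "r = (1 + norm w) / 2"
  have r: "norm w < r" "r < 1" using w by (auto simp: r_def)
  have "uniformly_convergent_on (cball 0 r) (\<lambda>k w. \<Prod>n<k. if n \<in> N then E n w else 1)"
  proof (rule uniformly_convergent_on_prod')
    fix n
    have "continuous_on (cball 0 r) (E n)"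
      by (rule continuous_on_subset[OF holomorphic_on_imp_continuous_on[OF E_holomorphic]]) (use r in auto)
    thus "continuous_on (cball 0 r) (\<lambda>w. if n \<in> N then E n w else 1)" by (cases "n \<in> N") simp_all
  qed (use uniformly_convergent_factors[OF r(2)] in auto)
  then obtain g where g: "uniform_limit (cball 0 r) (\<lambda>k w. \<Prod>n<k. if n \<in> N then E n w else 1) g sequentially"
    by (auto simp: uniformly_convergent_on_def)
  have "uniform_limit (cball 0 r) (\<lambda>k w. \<Prod>n<k. if n \<in> N then E n w else 1) (P N) sequentially"
  proof (subst uniform_limit_cong[of _ _ _ _ _ g])
    fix v :: complex assume v: "v \<in> cball 0 r"
    have "(\<lambda>k. \<Prod>n<k. if n \<in> N then E n v else 1) \<longlonglongrightarrow> P N v"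
      using P_LIMSEQ[of v N] v r by (simp add: prod.inter_restrict)
    thus "P N v = g v" using tendsto_uniform_limitI[OF g v] LIMSEQ_unique by blast
  qed (use g in auto)
  moreover have "cball w (r - norm w) \<subseteq> cball 0 r" by (simp add: cball_subset_cball_iff)
  ultimately show "\<exists>e>0. cball w e \<subseteq> ball 0 1 \<and>
      uniform_limit (cball w e) (\<lambda>k w. \<Prod>n<k. if n \<in> N then E n w else 1) (P N) sequentially"
    using r uniform_limit_on_subset by (intro exI[of _ "r - norm w"]) auto
next
  fix k show "(\<lambda>w. \<Prod>n<k. if n \<in> N then E n w else 1) holomorphic_on ball 0 1"
  proof (intro holomorphic_intros)
    fix n show "(\<lambda>w. if n \<in> N then E n w else 1) holomorphic_on ball 0 1"
      by (cases "n \<in> N") (simp_all add: E_holomorphic)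
  qed
qed simp

lemma P_Un:
  assumes "N \<inter> M = {}" "w \<in> ball 0 1" shows "P (N \<union> M) w = P N w * P M w"
proof -
  have "(\<Prod>n\<in>{..<k} \<inter> (N \<union> M). E n w) = (\<Prod>n\<in>{..<k} \<inter> N. E n w) * (\<Prod>n\<in>{..<k} \<inter> M. E n w)" for k
    unfolding Int_Un_distrib by (rule prod.union_disjoint) (use assms in auto)
  hence "(\<lambda>k. (\<Prod>n\<in>{..<k} \<inter> N. E n w) * (\<Prod>n\<in>{..<k} \<inter> M. E n w)) \<longlonglongrightarrow> P (N \<union> M) w"
    using P_LIMSEQ[OF assms(2), of "N \<union> M"] by simp
  moreover have "(\<lambda>k. (\<Prod>n\<in>{..<k} \<inter> N. E n w) * (\<Prod>n\<in>{..<k} \<inter> M. E n w)) \<longlonglongrightarrow> P N w * P M w"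
    by (intro tendsto_mult P_LIMSEQ assms)
  ultimately show ?thesis by (rule LIMSEQ_unique)
qed

lemma P_singleton:
  assumes "w \<in> ball 0 1" shows "P {k} w = E k w"
proof -
  have "eventually (\<lambda>j. (\<Prod>n\<in>{..<j} \<inter> {k}. E n w) = E k w) sequentially"
    using eventually_gt_at_top[of k] by eventually_elim auto
  hence "(\<lambda>j. \<Prod>n\<in>{..<j} \<inter> {k}. E n w) \<longlonglongrightarrow> E k w" by (rule tendsto_eventually)
  thus ?thesis using P_LIMSEQ[OF assms, of "{k}"] LIMSEQ_unique by blast
qed

lemma P_remove:
  assumes "w \<in> ball 0 1" shows "P UNIV w = E k w * P (-{k}) w"
  using P_Un[of "{k}" "-{k}" w] P_singleton[of w k] assms by simp

text \<open>Both bounds have constants independent of the index set, hence they pass to the limit in the infinite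
  products. The number \<open>23\<close> is chosen such that the minimum is \<open>1\<close> for every zero \<open>z n\<close> with
  \<open>|w - z n| \<ge> (1 - |w|) / 10\<close>: then \<open>d n \<le> 11 |w - z n|\<close> and
  \<open>|\<zeta> n - w| \<le> |z n - w| + 2 d n \<le> 23 |z n - w|\<close>.\<close>

lemma elementary_factor_bounds:
  obtains C where "C \<ge> 0"
    "\<And>I w. finite I \<Longrightarrow> w \<in> ball 0 1 \<Longrightarrow> norm (\<Prod>n\<in>I. E n w) \<le> exp (C * T (lev w))"
    "\<And>I w. finite I \<Longrightarrow> w \<in> ball 0 1 \<Longrightarrow>
       norm (\<Prod>n\<in>I. E n w) \<ge> exp (- (C * T (lev w))) * (\<Prod>n\<in>I. min 1 (23 * norm (1 - A n w)))"
proof -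
  obtain B where B: "B \<ge> 0" "\<And>u. norm u \<le> 2 \<Longrightarrow> norm (weierstrass_factor (s + 4) u) \<le> exp (B * norm u ^ (s + 5))"
    "\<And>u. norm u \<le> 2 \<Longrightarrow>
       norm (weierstrass_factor (s + 4) u) \<ge> exp (- (B * norm u ^ (s + 5))) * min 1 (23 * norm (1 - u))"
  proof -
    have "Suc (s + 4) = s + 5" by simp
    from weierstrass_factor_upper_lower[of "s + 4" 23, unfolded this] that show ?thesis by auto
  qed
  obtain D where D: "D \<ge> 0"
    "\<And>I w. finite I \<Longrightarrow> w \<in> ball 0 1 \<Longrightarrow> (\<Sum>n\<in>I. q n w ^ (s + 5)) \<le> D * T (lev w)"
    using sum_q_le by blast
  define C where "C = B * 2 ^ (s + 5) * D"
  have S: "(\<Sum>n\<in>I. B * norm (A n w) ^ (s + 5)) \<le> C * T (lev w)" if "finite I" "w \<in> ball 0 1" for I w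
  proof -
    have "(\<Sum>n\<in>I. B * norm (A n w) ^ (s + 5)) = B * 2 ^ (s + 5) * (\<Sum>n\<in>I. q n w ^ (s + 5))"
      by (simp only: norm_A power_mult_distrib sum_distrib_left mult.assoc)
    also have "\<dots> \<le> B * 2 ^ (s + 5) * (D * T (lev w))" by (rule mult_left_mono[OF D(2)[OF that]]) (use B in simp)
    finally show ?thesis by (simp only: C_def mult.assoc)
  qed
  show ?thesis
  proof (rule that[of C])
    show "C \<ge> 0" using B D by (simp add: C_def)
    fix I :: "nat set" and w :: complex assume I: "finite I" and w: "w \<in> ball 0 1"
    have "norm (\<Prod>n\<in>I. E n w) \<le> (\<Prod>n\<in>I. exp (B * norm (A n w) ^ (s + 5)))"
      unfolding prod_norm[symmetric] using B(2)[OF norm_A_le_2[OF w]] by (intro prod_mono) (auto simp: E_def)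
    also have "\<dots> = exp (\<Sum>n\<in>I. B * norm (A n w) ^ (s + 5))" by (rule exp_sum[OF I, symmetric])
    finally show "norm (\<Prod>n\<in>I. E n w) \<le> exp (C * T (lev w))" using S[OF I w] by (simp add: order_trans)
    have "exp (- (C * T (lev w))) * (\<Prod>n\<in>I. min 1 (23 * norm (1 - A n w)))
        \<le> exp (\<Sum>n\<in>I. - (B * norm (A n w) ^ (s + 5))) * (\<Prod>n\<in>I. min 1 (23 * norm (1 - A n w)))"
      using S[OF I w] by (intro mult_right_mono prod_nonneg) (auto simp: sum_negf)
    also have "\<dots> = (\<Prod>n\<in>I. exp (- (B * norm (A n w) ^ (s + 5))) * min 1 (23 * norm (1 - A n w)))"
      by (simp add: exp_sum[OF I] prod.distrib)
    also have "\<dots> \<le> norm (\<Prod>n\<in>I. E n w)"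
      unfolding prod_norm[symmetric] using B(3)[OF norm_A_le_2[OF w]] by (intro prod_mono) (auto simp: E_def)
    finally show "norm (\<Prod>n\<in>I. E n w) \<ge> exp (- (C * T (lev w))) * (\<Prod>n\<in>I. min 1 (23 * norm (1 - A n w)))" .
  qed
qed

lemma P_upper:
  obtains C where "C \<ge> 0" "\<And>N w. w \<in> ball 0 1 \<Longrightarrow> norm (P N w) \<le> exp (C * T (lev w))"
proof (rule elementary_factor_bounds)
  fix C assume C: "C \<ge> 0"
    "\<And>I w. finite I \<Longrightarrow> w \<in> ball 0 1 \<Longrightarrow> norm (\<Prod>n\<in>I. E n w) \<le> exp (C * T (lev w))"
  show ?thesis
  proof (rule that[OF C(1)])
    fix N and w :: complex assume w: "w \<in> ball 0 1"
    show "norm (P N w) \<le> exp (C * T (lev w))"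
      by (rule LIMSEQ_le_const2[OF tendsto_norm[OF P_LIMSEQ[OF w]]]) (use C(2)[OF _ w] in auto)
  qed
qed

lemma moderate_P: "moderate (P N)"
  using P_upper moderateI[OF P_holomorphic] by metis

lemma one_minus_A_ge:
  assumes "w \<in> ball 0 1" "norm (z n - w) + 2 * d n \<le> c * norm (z n - w)"
  shows "1 \<le> c * norm (1 - A n w)"
proof -
  have pos: "norm (\<zeta> n - w) > 0" by (rule zeta_dist_pos[OF assms(1)])
  have "norm (\<zeta> n - w) \<le> norm (z n - w) + 2 * d n"
    using norm_triangle_ineq[of "z n - w" "\<zeta> n - z n"] norm_zeta_minus_z[of n] by simp
  also note assms(2)
  finally show ?thesis using pos by (simp add: one_minus_A[OF assms(1)] norm_divide divide_simps mult_ac)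
qed

lemma d_le_dist: "d n \<le> 1 - norm w + norm (z n - w)"
  using norm_triangle_ineq2[of w "z n"] by (simp add: d_def norm_minus_commute)

lemma P_lower_far:
  obtains C where "C \<ge> 0"
    "\<And>N w. w \<in> ball 0 1 \<Longrightarrow> (\<And>n. n \<in> N \<Longrightarrow> (1 - norm w) / 10 \<le> norm (z n - w)) \<Longrightarrow>
       exp (- (C * T (lev w))) \<le> norm (P N w)"
proof (rule elementary_factor_bounds)
  fix C assume C: "C \<ge> 0"
    "\<And>I w. finite I \<Longrightarrow> w \<in> ball 0 1 \<Longrightarrow>
       norm (\<Prod>n\<in>I. E n w) \<ge> exp (- (C * T (lev w))) * (\<Prod>n\<in>I. min 1 (23 * norm (1 - A n w)))"
  show ?thesis
  proof (rule that[OF C(1)])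
    fix N and w :: complex assume w: "w \<in> ball 0 1"
      and far: "\<And>n. n \<in> N \<Longrightarrow> (1 - norm w) / 10 \<le> norm (z n - w)"
    have one: "min 1 (23 * norm (1 - A n w)) = 1" if "n \<in> N" for n
    proof -
      have "norm (z n - w) + 2 * d n \<le> 23 * norm (z n - w)"
        using far[OF that] d_le_dist[of n w] by (simp add: field_simps)
      from one_minus_A_ge[OF w this] show ?thesis by simp
    qed
    have "exp (- (C * T (lev w))) \<le> norm (\<Prod>n\<in>{..<k} \<inter> N. E n w)" for k
      using C(2)[of "{..<k} \<inter> N" w] w one by simp
    thus "exp (- (C * T (lev w))) \<le> norm (P N w)"
      by (intro LIMSEQ_le_const[OF tendsto_norm[OF P_LIMSEQ[OF w]]]) auto
  qed
qed

text \<open>Only the zeros \<open>z n\<close> with \<open>|z n - z k| \<le> d k / 2\<close> make the product small at \<open>z k\<close>; for these the factor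
  \<open>|1 - A n|\<close> is comparable with \<open>2 |z n - z k| / d k\<close>, and the product of these numbers is precisely what
  the separation hypothesis controls.\<close>

lemma P_lower_at_zero:
  obtains C where "C \<ge> 0" "\<And>k. exp (- (C * T (lev (z k)))) \<le> norm (P (-{k}) (z k))"
proof (rule elementary_factor_bounds)
  fix C assume C: "C \<ge> 0"
    "\<And>I w. finite I \<Longrightarrow> w \<in> ball 0 1 \<Longrightarrow>
       norm (\<Prod>n\<in>I. E n w) \<ge> exp (- (C * T (lev w))) * (\<Prod>n\<in>I. min 1 (23 * norm (1 - A n w)))"
  show ?thesis
  proof (rule that[of "C + C1"])
    show "C + C1 \<ge> 0" using C C1_nonneg by simp
    fix k
    have main: "exp (- ((C + C1) * T (lev (z k)))) \<le> norm (\<Prod>n\<in>I. E n (z k))" if I: "finite I" "k \<notin> I" for I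
    proof -
      define near where "near = {n\<in>I. norm (z n - z k) \<le> d k / 2}"
      define L where "L n = ln ((1 - norm (z k)) / (2 * norm (z n - z k)))" for n
      have pos: "norm (z n - z k) > 0" if "n \<in> I" for n using z_neq[of n k] that I by auto
      have ge: "exp (if n \<in> near then - L n else 0) \<le> min 1 (23 * norm (1 - A n (z k)))" if n: "n \<in> I" for n
      proof (cases "n \<in> near")
        case True
        have e: "exp (- L n) = 2 * norm (z n - z k) / d k"
          using pos[OF n] d_pos[of k] by (simp add: L_def exp_minus d_def)
        define t where "t = norm (z n - z k)"
        have t: "0 < t" "t \<le> d k / 2" using True pos[OF n] by (auto simp: near_def t_def)
        have dn: "d n \<le> d k + t" using d_le_dist[of n "z k"] by (simp add: d_def t_def)
        have "1 \<le> 4 * d k / t * norm (1 - A n (z k))"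
        proof (rule one_minus_A_ge[OF z_in])
          have "t + 2 * d n \<le> 4 * d k" using t dn by linarith
          thus "norm (z n - z k) + 2 * d n \<le> 4 * d k / t * norm (z n - z k)"
            using t by (simp add: t_def[symmetric])
        qed
        hence "t / d k \<le> 4 * norm (1 - A n (z k))" using t d_pos[of k] by (simp add: field_simps)
        hence "2 * t / d k \<le> 23 * norm (1 - A n (z k))"
          using norm_ge_zero[of "1 - A n (z k)"] by (simp del: norm_ge_zero)
        moreover have "2 * t / d k \<le> 1" using t d_pos[of k] by simp
        ultimately show ?thesis using True e by (simp add: t_def)
      next
        case False
        hence "d k \<le> 2 * norm (z n - z k)" using n by (auto simp: near_def)
        hence "norm (z n - z k) + 2 * d n \<le> 23 * norm (z n - z k)"
          using d_le_dist[of n "z k"] norm_ge_zero[of "z n - z k"]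
          unfolding d_def[of k] by linarith
        from one_minus_A_ge[OF z_in this] show ?thesis using False by simp
      qed
      have "exp (- ((C + C1) * T (lev (z k)))) = exp (- (C * T (lev (z k)))) * exp (- (C1 * T (lev (z k))))"
        by (simp add: distrib_right flip: exp_add)
      also have "\<dots> \<le> exp (- (C * T (lev (z k)))) * exp (\<Sum>n\<in>I. if n \<in> near then - L n else 0)"
      proof -
        have "(\<Sum>n\<in>near. L n) \<le> C1 * \<Psi> (lev (z k))" unfolding L_def
          by (rule separated) (use I in \<open>auto simp: near_def d_def\<close>)
        also have "\<dots> \<le> C1 * T (lev (z k))" by (intro mult_left_mono T_ge_Psi C1_nonneg)
        finally have "- (C1 * T (lev (z k))) \<le> (\<Sum>n\<in>near. - L n)" by (simp add: sum_negf)
        also have "\<dots> = (\<Sum>n\<in>I. if n \<in> near then - L n else 0)"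
          by (rule sum.mono_neutral_cong_left) (use I in \<open>auto simp: near_def\<close>)
        finally show ?thesis by simp
      qed
      also have "\<dots> \<le> exp (- (C * T (lev (z k)))) * (\<Prod>n\<in>I. min 1 (23 * norm (1 - A n (z k))))"
        unfolding exp_sum[OF I(1)] by (intro mult_left_mono prod_mono) (use ge in auto)
      also have "\<dots> \<le> norm (\<Prod>n\<in>I. E n (z k))" by (rule C(2)[OF I(1) z_in])
      finally show ?thesis .
    qed
    show "exp (- ((C + C1) * T (lev (z k)))) \<le> norm (P (-{k}) (z k))"
      by (rule LIMSEQ_le_const[OF tendsto_norm[OF P_LIMSEQ[OF z_in]]]) (use main in auto)
  qed
qed

text \<open>The elementary factor is \<open>(z k - w) exp (\<dots>) / (\<zeta> k - w)\<close>, so its derivative at \<open>z k\<close> is read off; the exponent is a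
  partial harmonic sum there and \<open>|\<zeta> k - z k| = 2 d k \<le> 2\<close>.\<close>

lemma deriv_E_ge: "norm (deriv (E k) (z k)) \<ge> 1 / 2"
proof -
  define S where "S w = (\<Sum>i=1..s+4. A k w ^ i / of_nat i)" for w
  define g where "g w = exp (S w) / (\<zeta> k - w)" for w
  have hS: "S holomorphic_on ball 0 1" unfolding S_def[abs_def]
    by (intro holomorphic_intros A_holomorphic) auto
  have hg: "g holomorphic_on ball 0 1" unfolding g_def[abs_def]
    by (intro holomorphic_intros hS) (use zeta_neq in auto)
  have "deriv (E k) (z k) = deriv (\<lambda>w. (z k - w) * g w) (z k)"
  proof (rule deriv_cong_ev)
    have "eventually (\<lambda>w. w \<in> ball 0 1) (nhds (z k))" using z_in by (intro eventually_nhds_in_open) auto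
    thus "eventually (\<lambda>w. E k w = (z k - w) * g w) (nhds (z k))"
      by eventually_elim (simp add: E_def weierstrass_factor_def one_minus_A g_def S_def)
  qed simp
  also have "\<dots> = - g (z k)"
  proof (rule DERIV_imp_deriv)
    have "(g has_field_derivative deriv g (z k)) (at (z k))"
      by (rule holomorphic_derivI[OF hg]) (use z_in in auto)
    thus "((\<lambda>w. (z k - w) * g w) has_field_derivative - g (z k)) (at (z k))"
      by (auto intro!: derivative_eq_intros)
  qed
  finally have "norm (deriv (E k) (z k)) = exp (Re (S (z k))) / (2 * d k)"
    by (simp add: g_def norm_divide norm_zeta_minus_z)
  also have "\<dots> \<ge> 1 / 2"
  proof -
    have "Re (S (z k)) = (\<Sum>i=1..s+4. 1 / real i)" by (simp add: S_def)
    also have "\<dots> \<ge> 0" by (intro sum_nonneg) auto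
    finally have "1 \<le> exp (Re (S (z k)))" by simp
    hence "d k \<le> exp (Re (S (z k)))" using d_le_1[of k] by linarith
    thus ?thesis using d_pos[of k] by (simp add: divide_simps)
  qed
  finally show ?thesis .
qed

lemma deriv_P_lower:
  obtains C where "C \<ge> 0" "\<And>k. exp (- (C * T (lev (z k)))) \<le> norm (deriv (P UNIV) (z k))"
proof -
  obtain C where C: "C \<ge> 0" "\<And>k. exp (- (C * T (lev (z k)))) \<le> norm (P (-{k}) (z k))"
    using P_lower_at_zero by blast
  obtain B where B: "B \<ge> 0" "\<And>m. 2 \<le> exp (B * T m)" using const_le_exp_T[of 2] by auto
  show ?thesis
  proof (rule that[of "B + C"])
    show "B + C \<ge> 0" using B C by simp
    fix k
    have "deriv (P UNIV) (z k) = deriv (\<lambda>w. E k w * P (-{k}) w) (z k)"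
    proof (rule deriv_cong_ev)
      have "eventually (\<lambda>w. w \<in> ball 0 1) (nhds (z k))" using z_in by (intro eventually_nhds_in_open) auto
      thus "eventually (\<lambda>w. P UNIV w = E k w * P (-{k}) w) (nhds (z k))"
        by eventually_elim (rule P_remove)
    qed simp
    also have "\<dots> = deriv (E k) (z k) * P (-{k}) (z k)"
    proof (rule DERIV_imp_deriv)
      have "(E k has_field_derivative deriv (E k) (z k)) (at (z k))"
        by (rule holomorphic_derivI[OF E_holomorphic]) (use z_in in auto)
      moreover have "(P (-{k}) has_field_derivative deriv (P (-{k})) (z k)) (at (z k))"
        by (rule holomorphic_derivI[OF P_holomorphic]) (use z_in in auto)
      moreover have "E k (z k) = 0" by (simp add: E_def)
      ultimately show "((\<lambda>w. E k w * P (-{k}) w) has_field_derivative deriv (E k) (z k) * P (-{k}) (z k)) (at (z k))"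
        by (auto intro!: derivative_eq_intros)
    qed
    finally have eq: "norm (deriv (P UNIV) (z k)) = norm (deriv (E k) (z k)) * norm (P (-{k}) (z k))"
      by (simp add: norm_mult)
    have "exp (- ((B + C) * T (lev (z k)))) = exp (- (B * T (lev (z k)))) * exp (- (C * T (lev (z k))))"
      by (simp add: distrib_right flip: exp_add)
    also have "\<dots> \<le> 1 / 2 * norm (P (-{k}) (z k))"
    proof (rule mult_mono)
      show "exp (- (B * T (lev (z k)))) \<le> 1 / 2"
        using B(2)[of "lev (z k)"] by (simp add: exp_minus divide_simps)
    qed (use C(2) in auto)
    also have "\<dots> \<le> norm (deriv (P UNIV) (z k))" unfolding eq by (intro mult_right_mono deriv_E_ge) simp
    finally show "exp (- ((B + C) * T (lev (z k)))) \<le> norm (deriv (P UNIV) (z k))" .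
  qed
qed

section \<open>Interpolation\<close>

text \<open>The powers of \<open>A k\<close> are the convergence factors of the interpolation series. Let \<open>j = lev (z k)\<close> and
  \<open>m = lev w\<close>. If \<open>j > m + 4\<close>, then \<open>|A k w| \<le> 4 * 2^(m - j)\<close>, and an exponent of size \<open>M \<Psi> j\<close> gives a
  decay \<open>exp (- c M (j - m) \<Psi> j)\<close>, which compensates \<open>T j \<le> T m + (j - m) \<Psi> j\<close> and leaves a power of
  \<open>2^(m - j)\<close> for the convergence of the series. If \<open>j \<le> m + 4\<close>, then \<open>|A k w| \<le> 2\<close> costs at most
  \<open>2^(M \<Psi> j + 1)\<close>, which is within the scale.\<close>

lemma interpolation_weight_bound:
  assumes D: "D \<ge> 0"
  obtains M C where "C \<ge> 0"
    "\<And>k w. w \<in> ball 0 1 \<Longrightarrow>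
       exp (D * T (lev (z k))) * norm (A k w) ^ nat \<lceil>M * \<Psi> (lev (z k))\<rceil> \<le> exp (C * T (lev w)) * d k ^ (s + 5)"
proof -
  define p where "p = s + 5"
  \<comment> \<open>\<open>ln 2 / 2 * M\<close> has to exceed \<open>D\<close> by enough to leave \<open>exp (- p (j - m))\<close> over.\<close>
  define M where "M = 2 / ln 2 * (D + real p / \<Psi> 0)"
  have M0: "M \<ge> 0" unfolding M_def using D Psi_pos[of 0] by simp
  define \<kappa> :: real where "\<kappa> = (1 + 2 ^ s) ^ 4"
  have \<kappa>: "\<kappa> \<ge> 1" unfolding \<kappa>_def by (rule one_le_power) simp
  obtain F where F: "F \<ge> 0" "\<And>m. 2 ^ (5 * p * Suc m) \<le> exp (F * T m)"
    using power_le_exp_T[of "5 * p"] by auto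
  obtain G where G: "G \<ge> 0" "\<And>m. exp 1 \<le> exp (G * T m)" using const_le_exp_T[of "exp 1"] by auto
  define C where "C = D * \<kappa> + M * \<kappa> + G + F"
  have main: "exp (D * T (lev (z k))) * norm (A k w) ^ nat \<lceil>M * \<Psi> (lev (z k))\<rceil> \<le> exp (C * T (lev w)) * d k ^ p"
    if w: "w \<in> ball 0 1" for k w
  proof -
    define j where "j = lev (z k)"
    define m where "m = lev w"
    define \<sigma> where "\<sigma> = nat \<lceil>M * \<Psi> j\<rceil>"
    have MP: "M * \<Psi> j \<ge> 0" using M0 Psi_pos[of j] by simp
    have \<sigma>: "M * \<Psi> j \<le> real \<sigma>" "real \<sigma> \<le> M * \<Psi> j + 1" unfolding \<sigma>_def using MP by linarith+
    have dj: "1 < 2 ^ Suc j * d k" "2 ^ j * d k \<le> 1" using d_lev[of k] by (auto simp: j_def)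
    have Tm: "T m \<ge> 0" using T_pos[of m] by simp
    have A2: "norm (A k w) \<le> 2" by (rule norm_A_le_2[OF w])
    have "exp (D * T j) * norm (A k w) ^ \<sigma> \<le> exp (C * T m) * d k ^ p"
    proof (cases "j \<le> m + 4")
      case True
      have Tj: "T j \<le> \<kappa> * T m" using T_mono[OF True] T_shift[of m 4] by (simp add: \<kappa>_def)
      have "norm (A k w) ^ \<sigma> \<le> 2 ^ \<sigma>" by (rule power_mono[OF A2]) simp
      also have "\<dots> \<le> exp 1 ^ \<sigma>" by (rule power_mono) (use exp_ge_add_one_self[of 1] in auto)
      also have "\<dots> = exp (real \<sigma>)" by (simp flip: exp_of_nat_mult)
      also have "\<dots> \<le> exp (M * (\<kappa> * T m) + G * T m)"
      proof -
        have "M * \<Psi> j \<le> M * (\<kappa> * T m)" using T_ge_Psi[of j] Tj by (intro mult_left_mono M0) simp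
        moreover have "1 \<le> G * T m" using G(2)[of m] by simp
        ultimately show ?thesis using \<sigma>(2) by simp
      qed
      finally have 1: "norm (A k w) ^ \<sigma> \<le> exp (M * (\<kappa> * T m) + G * T m)" .
      have 2: "exp (D * T j) \<le> exp (D * (\<kappa> * T m))" using mult_left_mono[OF Tj D] by simp
      have "1 \<le> 2 ^ Suc (m + 4) * d k"
      proof -
        have "(2::real) ^ Suc j * d k \<le> 2 ^ Suc (m + 4) * d k"
          using True d_pos[of k] by (intro mult_right_mono power_increasing) auto
        thus ?thesis using dj by linarith
      qed
      hence "1 \<le> (2 ^ Suc (m + 4) * d k) ^ p" by (rule one_le_power)
      also have "\<dots> = 2 ^ (p * (m + 5)) * d k ^ p" by (simp add: power_mult_distrib mult.commute flip: power_mult)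
      also have "\<dots> \<le> 2 ^ (5 * p * Suc m) * d k ^ p"
      proof -
        have "p * (m + 5) \<le> p * (5 * Suc m)" by (rule mult_left_mono) auto
        hence "p * (m + 5) \<le> 5 * p * Suc m" by (simp only: mult_ac)
        thus ?thesis using d_pos[of k] by (intro mult_right_mono power_increasing) auto
      qed
      also have "\<dots> \<le> exp (F * T m) * d k ^ p"
        using d_pos[of k] by (intro mult_right_mono F) auto
      finally have 3: "1 \<le> exp (F * T m) * d k ^ p" .
      have "exp (D * T j) * norm (A k w) ^ \<sigma> \<le> exp (D * (\<kappa> * T m)) * exp (M * (\<kappa> * T m) + G * T m)"
        by (rule mult_mono[OF 2 1]) auto
      also have "\<dots> \<le> exp (D * (\<kappa> * T m)) * exp (M * (\<kappa> * T m) + G * T m) * (exp (F * T m) * d k ^ p)"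
        using mult_left_mono[OF 3, of "exp (D * (\<kappa> * T m)) * exp (M * (\<kappa> * T m) + G * T m)"] by simp
      also have "\<dots> = exp (C * T m) * d k ^ p" by (simp add: C_def exp_add algebra_simps)
      finally show ?thesis .
    next
      case False
      define e where "e = j - m"
      have e: "e \<ge> 4" "j = m + e" using False by (auto simp: e_def)
      have radial: "norm (A k w) \<le> 4 * (1/2) ^ e"
      proof -
        have "norm (A k w) \<le> 2 * (d k / (1 - norm w))" unfolding norm_A using q_le_radial[OF w, of k] by simp
        also have "d k / (1 - norm w) \<le> 2 * (1/2) ^ e"
        proof -
          have "d k * 2 ^ e * 2 ^ m \<le> 1" using dj(2) by (simp add: e(2) power_add mult_ac)
          also have "1 \<le> 2 ^ Suc m * (1 - norm w)" using lev_gt[OF w] by (simp add: m_def)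
          finally have "d k * 2 ^ e * 2 ^ m \<le> 2 * (1 - norm w) * 2 ^ m" by (simp add: mult_ac)
          hence "d k * 2 ^ e \<le> 2 * (1 - norm w)" by simp
          thus ?thesis using w by (simp add: divide_simps power_one_over mult_ac)
        qed
        finally show ?thesis by simp
      qed
      have "exp (2 * ln 2) = (4::real)" using exp_of_nat_mult[of 2 "ln (2::real)"] by simp
      moreover have "exp (real e * ln 2) = (2::real) ^ e" by (simp add: exp_of_nat_mult)
      ultimately have "4 * (1/2) ^ e = exp (2 * ln 2 - real e * ln 2)"
        by (simp only: exp_diff) (simp add: power_one_over)
      also have "\<dots> = exp (ln 2 * (2 - real e))" by (simp add: algebra_simps)
      also have "\<dots> \<le> exp (- (ln 2 / 2) * real e)"
      proof -
        have "ln 2 * (2 - real e) \<le> ln 2 * (- real e / 2)" using e(1) by (intro mult_left_mono) auto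
        thus ?thesis by simp
      qed
      finally have "norm (A k w) \<le> exp (- (ln 2 / 2) * real e)" using radial by simp
      hence "norm (A k w) ^ \<sigma> \<le> exp (- (ln 2 / 2) * real e) ^ \<sigma>" by (rule power_mono) simp
      also have "\<dots> = exp (- (ln 2 / 2 * real e) * real \<sigma>)" by (simp add: mult.commute flip: exp_of_nat_mult)
      also have "\<dots> \<le> exp (- (ln 2 / 2 * real e) * (M * \<Psi> j))"
        using \<sigma>(1) by (simp add: mult_left_mono)
      also have "- (ln 2 / 2 * real e) * (M * \<Psi> j) = - (D + real p / \<Psi> 0) * (real e * \<Psi> j)"
      proof -
        have "ln 2 / 2 * M = D + real p / \<Psi> 0" by (simp add: M_def)
        moreover have "- (ln 2 / 2 * real e) * (M * \<Psi> j) = - (ln 2 / 2 * M) * (real e * \<Psi> j)"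
          by (simp add: algebra_simps)
        ultimately show ?thesis by (simp only:)
      qed
      finally have 1: "norm (A k w) ^ \<sigma> \<le> exp (- (D + real p / \<Psi> 0) * (real e * \<Psi> j))" .
      have 2: "exp (D * T j) \<le> exp (D * T m + D * (real e * \<Psi> j))"
        using mult_left_mono[OF T_diff_le[of m j] D] e by (simp add: algebra_simps)
      have "exp (D * T j) * norm (A k w) ^ \<sigma>
         \<le> exp (D * T m + D * (real e * \<Psi> j)) * exp (- (D + real p / \<Psi> 0) * (real e * \<Psi> j))"
        by (rule mult_mono[OF 2 1]) auto
      also have "\<dots> = exp (D * T m) * exp (- (real p * real e * (\<Psi> j / \<Psi> 0)))"
        by (simp add: algebra_simps flip: exp_add)
      also have "\<dots> \<le> exp (D * T m) * (exp (F * T m) * d k ^ p)"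
      proof (rule mult_left_mono)
        have "1 \<le> \<Psi> j / \<Psi> 0" using Psi_mono[of 0 j] Psi_pos[of 0] by simp
        hence "real p * real e * 1 \<le> real p * real e * (\<Psi> j / \<Psi> 0)" by (intro mult_left_mono) auto
        hence "exp (- (real p * real e * (\<Psi> j / \<Psi> 0))) \<le> exp (- real e) ^ p"
          by (simp flip: exp_of_nat_mult)
        also have "\<dots> \<le> (2 ^ Suc m * d k) ^ p"
        proof (rule power_mono)
          have "(2::real) ^ e \<le> exp 1 ^ e" by (rule power_mono) (use exp_ge_add_one_self[of 1] in auto)
          also have "\<dots> = exp (real e)" by (simp flip: exp_of_nat_mult)
          finally have "exp (- real e) \<le> 1 / 2 ^ e" by (simp add: exp_minus divide_simps)
          also have "\<dots> \<le> 2 ^ Suc m * d k" using dj(1) by (simp add: e(2) power_add divide_simps mult_ac)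
          finally show "exp (- real e) \<le> 2 ^ Suc m * d k" .
        qed simp
        also have "\<dots> = 2 ^ (p * Suc m) * d k ^ p" by (simp only: power_mult_distrib mult.commute flip: power_mult)
        also have "\<dots> \<le> 2 ^ (5 * p * Suc m) * d k ^ p"
          using d_pos[of k] by (intro mult_right_mono power_increasing) auto
        also have "\<dots> \<le> exp (F * T m) * d k ^ p"
          using d_pos[of k] by (intro mult_right_mono F) auto
        finally show "exp (- (real p * real e * (\<Psi> j / \<Psi> 0))) \<le> exp (F * T m) * d k ^ p" .
      qed simp
      also have "\<dots> = exp ((D + F) * T m) * d k ^ p" by (simp add: exp_add algebra_simps)
      also have "\<dots> \<le> exp (C * T m) * d k ^ p"
      proof -
        have "D * 1 \<le> D * \<kappa>" by (rule mult_left_mono[OF \<kappa> D])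
        moreover have "M * \<kappa> \<ge> 0" using M0 \<kappa> by simp
        ultimately have "D + F \<le> C" using G(1) by (simp add: C_def)
        thus ?thesis using Tm d_pos[of k] by (intro mult_right_mono) (auto intro: mult_right_mono)
      qed
      finally show ?thesis .
    qed
    thus ?thesis by (simp add: j_def m_def \<sigma>_def)
  qed
  show ?thesis
    by (rule that[of C M]) (use main D M0 \<kappa> G F in \<open>auto simp: C_def p_def intro!: add_nonneg_nonneg mult_nonneg_nonneg\<close>)
qed

text \<open>The series is \<open>\<Sum>k. b k * (P\<^sub>k w / P\<^sub>k (z k)) * A k w ^ \<sigma> k\<close>, where \<open>P\<^sub>k\<close> is the product without
  the \<open>k\<close>-th factor. At \<open>z l\<close> all terms but the \<open>l\<close>-th vanish, and \<open>A l (z l) = 1\<close>. The lower bound for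
  \<open>P\<^sub>k (z k)\<close> keeps the coefficients within the scale.\<close>

lemma interpolation:
  assumes B: "B \<ge> 0" and b: "\<And>k. norm (b k) \<le> exp (B * T (lev (z k)))"
  obtains h where "moderate h" "\<And>k. h (z k) = b k"
proof -
  obtain U where U: "U \<ge> 0" "\<And>N w. w \<in> ball 0 1 \<Longrightarrow> norm (P N w) \<le> exp (U * T (lev w))"
    using P_upper by blast
  obtain L where L: "L \<ge> 0" "\<And>k. exp (- (L * T (lev (z k)))) \<le> norm (P (-{k}) (z k))"
    using P_lower_at_zero by blast
  have "B + L \<ge> 0" using B L by simp
  then obtain M C where C: "C \<ge> 0" "\<And>k w. w \<in> ball 0 1 \<Longrightarrow>
       exp ((B + L) * T (lev (z k))) * norm (A k w) ^ nat \<lceil>M * \<Psi> (lev (z k))\<rceil> \<le> exp (C * T (lev w)) * d k ^ (s + 5)"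
    using interpolation_weight_bound by metis
  define c where "c k = b k / P (-{k}) (z k)" for k
  define \<sigma> where "\<sigma> k = nat \<lceil>M * \<Psi> (lev (z k))\<rceil>" for k
  define t where "t k w = c k * P (-{k}) w * A k w ^ \<sigma> k" for k w
  have nz: "P (-{k}) (z k) \<noteq> 0" for k
    using P_eq_0_iff[OF z_in[of k], of "-{k}"] z_neq by auto
  have c: "norm (c k) \<le> exp ((B + L) * T (lev (z k)))" for k
  proof -
    have "norm (c k) \<le> exp (B * T (lev (z k))) / exp (- (L * T (lev (z k))))"
      unfolding c_def norm_divide by (intro frac_le b L) auto
    thus ?thesis by (simp add: exp_minus divide_inverse distrib_right exp_add)
  qed
  show ?thesis
  proof (rule that[of "\<lambda>w. \<Sum>k. t k w"])
    show "moderate (\<lambda>w. \<Sum>k. t k w)"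
    proof (rule moderate_suminf[of _ "U + C" "\<lambda>k. d k ^ (s + 5)"])
      show "t k holomorphic_on ball 0 1" for k unfolding t_def[abs_def]
        by (intro holomorphic_intros P_holomorphic A_holomorphic)
      fix k and w :: complex assume w: "w \<in> ball 0 1"
      have "norm (t k w) = norm (P (-{k}) w) * (norm (c k) * norm (A k w) ^ \<sigma> k)"
        by (simp add: t_def norm_mult norm_power)
      also have "\<dots> \<le> exp (U * T (lev w)) * (exp ((B + L) * T (lev (z k))) * norm (A k w) ^ \<sigma> k)"
        by (intro mult_mono U w c order_refl) (auto intro!: mult_nonneg_nonneg)
      also have "\<dots> \<le> exp (U * T (lev w)) * (exp (C * T (lev w)) * d k ^ (s + 5))"
        unfolding \<sigma>_def by (intro mult_left_mono C w) auto
      finally show "norm (t k w) \<le> exp ((U + C) * T (lev w)) * d k ^ (s + 5)"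
        by (simp add: distrib_right exp_add)
    qed (use U C summable_d d_pos in \<open>auto intro: less_imp_le\<close>)
    fix k
    have "t l (z k) = 0" if "l \<noteq> k" for l
      using P_eq_0_iff[OF z_in[of k], of "-{l}"] that by (auto simp: t_def)
    hence "(\<Sum>l. t l (z k)) = (\<Sum>l\<in>{k}. t l (z k))" by (intro suminf_finite) auto
    also have "\<dots> = b k" using nz[of k] by (simp add: t_def c_def)
    finally show "(\<Sum>l. t l (z k)) = b k" .
  qed
qed

section \<open>Division by the canonical product\<close>

lemma deriv_P_nonzero: "deriv (P UNIV) (z k) \<noteq> 0"
proof -
  obtain C where "exp (- (C * T (lev (z k)))) \<le> norm (deriv (P UNIV) (z k))"
    using deriv_P_lower by metis
  moreover have "0 < exp (- (C * T (lev (z k))))" by simp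
  ultimately show ?thesis by (metis norm_zero not_le)
qed

text \<open>Fix \<open>w\<close>, let \<open>\<rho> = (1 - |w|) / 8\<close>, let \<open>N\<close> index the zeros in the disc of radius \<open>\<rho>\<close> about \<open>w\<close>, and put
  \<open>F = R / P\<close>. The product over \<open>N\<close> has no zero near the circle of radius \<open>2 \<rho>\<close>, hence is bounded from below
  there, so \<open>G = F * P (-N)\<close>, which is \<open>R\<close> divided by that product, is bounded from above on this circle and then, by
  the maximum principle, at \<open>w\<close>. The complementary product \<open>P (-N)\<close> has no zero near \<open>w\<close>, hence is bounded from below
  at \<open>w\<close>, and dividing by it bounds \<open>F w\<close>.\<close>

lemma moderate_division:
  assumes R: "moderate R" and zero: "\<And>k. R (z k) = 0"
  obtains F where "moderate F" "\<And>w. w \<in> ball 0 1 \<Longrightarrow> R w = F w * P UNIV w"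
proof -
  obtain F where F: "F holomorphic_on ball 0 1" "\<And>w. w \<in> ball 0 1 \<Longrightarrow> R w = F w * P UNIV w"
  proof (rule holomorphic_quotient_simple_zeros[of "ball 0 1" R "P UNIV"])
    fix a :: complex assume "a \<in> ball 0 1" "P UNIV a = 0"
    then obtain k where "a = z k" using P_eq_0_iff by blast
    thus "R a = 0 \<and> deriv (P UNIV) a \<noteq> 0" using zero deriv_P_nonzero by simp
  qed (use moderate_holomorphic[OF R] P_holomorphic in auto)
  obtain CR where CR: "CR \<ge> 0" "\<And>w. w \<in> ball 0 1 \<Longrightarrow> norm (R w) \<le> exp (CR * T (lev w))"
    using moderate_boundE[OF R] by blast
  obtain L where L: "L \<ge> 0"
    "\<And>N w. w \<in> ball 0 1 \<Longrightarrow> (\<And>n. n \<in> N \<Longrightarrow> (1 - norm w) / 10 \<le> norm (z n - w)) \<Longrightarrow>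
       exp (- (L * T (lev w))) \<le> norm (P N w)"
    using P_lower_far by blast
  define \<kappa> :: real where "\<kappa> = 1 + 2 ^ s"
  have "moderate F"
  proof (rule moderateI[OF F(1), of "(CR + L) * \<kappa> + L"])
    show "0 \<le> (CR + L) * \<kappa> + L" using CR L by (simp add: \<kappa>_def add_nonneg_nonneg)
    fix w :: complex assume w: "w \<in> ball 0 1"
    define \<rho> where "\<rho> = (1 - norm w) / 8"
    have \<rho>: "\<rho> > 0" using w by (simp add: \<rho>_def)
    have nw: "1 - norm w = 8 * \<rho>" by (simp add: \<rho>_def)
    define N where "N = {n. norm (z n - w) < \<rho>}"
    define G where "G v = F v * P (-N) v" for v
    have G_hol: "G holomorphic_on ball 0 1" unfolding G_def[abs_def]
      by (intro holomorphic_intros F P_holomorphic)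
    have sub: "cball w (2 * \<rho>) \<subseteq> ball 0 1"
    proof
      fix v assume "v \<in> cball w (2 * \<rho>)"
      hence "norm v \<le> norm w + 2 * \<rho>"
        using norm_triangle_ineq[of w "v - w"] by (simp add: dist_norm norm_minus_commute)
      thus "v \<in> ball 0 1" using nw \<rho> by simp
    qed
    have circle: "norm (G v) \<le> exp ((CR + L) * \<kappa> * T (lev w))" if v: "norm (w - v) = 2 * \<rho>" for v
    proof -
      have "v \<in> cball w (2 * \<rho>)" using v by (simp add: dist_norm)
      hence v1: "v \<in> ball 0 1" using sub by blast
      have "norm w \<le> norm v + 2 * \<rho>" using norm_triangle_ineq[of v "w - v"] v by simp
      hence nv: "1 - norm v \<le> 10 * \<rho>" using nw by simp
      have "norm v \<le> norm w + 2 * \<rho>" using norm_triangle_ineq[of w "v - w"] v by (simp add: norm_minus_commute)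
      hence "1 - norm w \<le> 2 ^ 1 * (1 - norm v)" using nw \<rho> by simp
      hence "lev v \<le> lev w + 1" by (rule lev_mono[OF v1 w])
      hence Tv: "T (lev v) \<le> \<kappa> * T (lev w)"
        using T_mono[of "lev v" "lev w + 1"] T_shift[of "lev w" 1] by (simp add: \<kappa>_def)
      have low: "exp (- (L * T (lev v))) \<le> norm (P N v)"
      proof (rule L(2)[OF v1])
        fix n assume "n \<in> N"
        hence "norm (z n - w) < \<rho>" by (simp add: N_def)
        hence "norm (z n - v) \<ge> \<rho>" using norm_triangle_ineq4[of "z n - v" "z n - w"] v by simp
        thus "(1 - norm v) / 10 \<le> norm (z n - v)" using nv by simp
      qed
      have "R v = G v * P N v"
        using F(2)[OF v1] P_Un[of N "-N" v] v1 by (simp add: G_def Compl_partition)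
      hence "norm (G v) * norm (P N v) \<le> exp (CR * T (lev v))"
        using CR(2)[OF v1] by (simp add: norm_mult)
      moreover have "norm (G v) * exp (- (L * T (lev v))) \<le> norm (G v) * norm (P N v)"
        by (rule mult_left_mono[OF low]) simp
      ultimately have "norm (G v) * exp (- (L * T (lev v))) \<le> exp (CR * T (lev v))" by linarith
      hence "norm (G v) \<le> exp ((CR + L) * T (lev v))"
        by (simp add: exp_minus distrib_right exp_add divide_simps)
      also have "(CR + L) * T (lev v) \<le> (CR + L) * (\<kappa> * T (lev w))"
        using CR L by (intro mult_left_mono Tv) simp
      finally show ?thesis by (simp add: mult.assoc)
    qed
    \<comment> \<open>Cauchy's inequality for the derivative of order \<open>0\<close> is the maximum principle at the centre.\<close>
    have "norm ((deriv ^^ 0) G w) \<le> fact 0 * exp ((CR + L) * \<kappa> * T (lev w)) / (2 * \<rho>) ^ 0"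
    proof (rule Cauchy_inequality)
      show "G holomorphic_on ball w (2 * \<rho>)"
        using holomorphic_on_subset[OF G_hol] sub ball_subset_cball by blast
      show "continuous_on (cball w (2 * \<rho>)) G"
        using continuous_on_subset[OF holomorphic_on_imp_continuous_on[OF G_hol] sub] .
    qed (use \<rho> circle in auto)
    hence "norm (F w) * norm (P (-N) w) \<le> exp ((CR + L) * \<kappa> * T (lev w))" by (simp add: G_def norm_mult)
    moreover have "norm (F w) * exp (- (L * T (lev w))) \<le> norm (F w) * norm (P (-N) w)"
    proof (intro mult_left_mono L(2)[OF w])
      fix n assume "n \<in> -N"
      hence "\<rho> \<le> norm (z n - w)" by (simp add: N_def)
      thus "(1 - norm w) / 10 \<le> norm (z n - w)" using nw \<rho> by simp
    qed simp
    ultimately have "norm (F w) * exp (- (L * T (lev w))) \<le> exp ((CR + L) * \<kappa> * T (lev w))" by linarith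
    thus "norm (F w) \<le> exp (((CR + L) * \<kappa> + L) * T (lev w))"
      by (simp add: exp_minus distrib_right exp_add divide_simps)
  qed
  thus ?thesis using F(2) by (rule that)
qed

section \<open>The differential equation\<close>

text \<open>Here \<open>f = p exp g\<close> with \<open>g' = h = h0 + c p\<close>, where \<open>h0\<close> solves the interpolation problem that makes
  \<open>p'' + 2 h0 p'\<close> divisible by \<open>p\<close>. The value \<open>a 0\<close> is a polynomial in \<open>c\<close> whose coefficients of
  degree two and one are \<open>- p(0)\<^sup>2\<close> and \<open>- (3 p'(0) + 2 h0(0) p(0))\<close>. These do not
  vanish simultaneously since the zeros of \<open>p\<close> are simple, so \<open>c\<close> can be chosen with \<open>a 0 = 0\<close>.\<close>

lemma moderate_coefficient_exists:
  "\<exists>a f. moderate a \<and> a 0 = 0 \<and> f holomorphic_on ball 0 1 \<and>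
     (\<forall>w\<in>ball 0 1. deriv (deriv f) w + a w * f w = 0) \<and>
     {w \<in> ball 0 1. f w = 0} = range z"
proof -
  define p where "p = P UNIV"
  have mp: "moderate p" unfolding p_def by (rule moderate_P)
  have mp': "moderate (deriv p)" and mp'': "moderate (deriv (deriv p))"
    using mp by (auto intro: moderate_deriv)
  have p0: "p w = 0 \<longleftrightarrow> w \<in> range z" if "w \<in> ball 0 1" for w
    unfolding p_def by (rule P_eq_0_iff[OF that])
  have p'0: "deriv p (z k) \<noteq> 0" for k unfolding p_def by (rule deriv_P_nonzero)
  obtain U where U: "U \<ge> 0" "\<And>w. w \<in> ball 0 1 \<Longrightarrow> norm (deriv (deriv p) w) \<le> exp (U * T (lev w))"
    using moderate_boundE[OF mp''] by blast
  obtain L where L: "L \<ge> 0" "\<And>k. exp (- (L * T (lev (z k)))) \<le> norm (deriv p (z k))"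
    using deriv_P_lower unfolding p_def by blast
  define b where "b k = - deriv (deriv p) (z k) / (2 * deriv p (z k))" for k
  have b: "norm (b k) \<le> exp ((U + L) * T (lev (z k)))" for k
  proof -
    have "norm (b k) = norm (deriv (deriv p) (z k)) / (2 * norm (deriv p (z k)))"
      by (simp add: b_def norm_divide norm_mult)
    also have "\<dots> \<le> norm (deriv (deriv p) (z k)) / norm (deriv p (z k))"
      using p'0[of k] by (intro divide_left_mono) auto
    also have "\<dots> \<le> exp (U * T (lev (z k))) / exp (- (L * T (lev (z k))))"
      by (intro frac_le U L z_in) auto
    also have "\<dots> = exp ((U + L) * T (lev (z k)))" by (simp add: exp_minus divide_inverse distrib_right exp_add)
    finally show ?thesis .
  qed
  have "U + L \<ge> 0" using U L by simp
  then obtain h0 where h0: "moderate h0" "\<And>k. h0 (z k) = b k"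
    using interpolation[OF _ b] by metis
  define R where "R w = deriv (deriv p) w + 2 * (h0 w * deriv p w)" for w
  have "moderate R" unfolding R_def[abs_def]
    by (intro moderate_add mp'' moderate_cmult moderate_mult mp' h0)
  moreover have "R (z k) = 0" for k using p'0[of k] by (simp add: R_def h0(2) b_def)
  ultimately obtain F where F: "moderate F" "\<And>w. w \<in> ball 0 1 \<Longrightarrow> R w = F w * p w"
    using moderate_division unfolding p_def by metis
  obtain c where c: "(p 0)\<^sup>2 * c\<^sup>2 + (3 * deriv p 0 + 2 * h0 0 * p 0) * c + (F 0 + deriv h0 0 + (h0 0)\<^sup>2) = 0"
  proof (rule quadratic_root_exists)
    show "(p 0)\<^sup>2 \<noteq> 0 \<or> 3 * deriv p 0 + 2 * h0 0 * p 0 \<noteq> 0"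
    proof (cases "p 0 = 0")
      case True
      then obtain k where "z k = 0" using p0[of 0] by auto
      thus ?thesis using True p'0[of k] by simp
    qed simp
  qed
  define h where "h w = h0 w + c * p w" for w
  have mh: "moderate h" unfolding h_def[abs_def] by (intro moderate_add h0 moderate_cmult mp)
  define a where "a w = - (F w + 2 * (c * deriv p w) + (deriv h w + h w * h w))" for w
  have ma: "moderate a" unfolding a_def[abs_def]
    by (intro moderate_minus moderate_add moderate_cmult moderate_mult moderate_deriv F mh mp)
  have dh: "deriv h 0 = deriv h0 0 + c * deriv p 0"
  proof (rule DERIV_imp_deriv)
    have "(h0 has_field_derivative deriv h0 0) (at 0)" "(p has_field_derivative deriv p 0) (at 0)"
      by (rule holomorphic_derivI[OF moderate_holomorphic[OF h0(1)]]; simp)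
        (rule holomorphic_derivI[OF moderate_holomorphic[OF mp]]; simp)
    thus "(h has_field_derivative deriv h0 0 + c * deriv p 0) (at 0)"
      unfolding h_def[abs_def] by (auto intro!: derivative_eq_intros)
  qed
  have "a 0 = - ((p 0)\<^sup>2 * c\<^sup>2 + (3 * deriv p 0 + 2 * h0 0 * p 0) * c + (F 0 + deriv h0 0 + (h0 0)\<^sup>2))"
    unfolding a_def dh h_def by (simp add: algebra_simps power2_eq_square)
  hence a0: "a 0 = 0" using c by simp
  obtain g where g: "\<And>w. w \<in> ball 0 1 \<Longrightarrow> (g has_field_derivative h w) (at w within ball 0 1)"
    using holomorphic_convex_primitive'[of "ball 0 1" h] moderate_holomorphic[OF mh] by auto
  have g': "(g has_field_derivative h w) (at w)" if "w \<in> ball 0 1" for w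
    using g[OF that] at_within_open[OF that open_ball] by simp
  define f where "f w = p w * exp (g w)" for w
  have ghol: "g holomorphic_on ball 0 1" 
    unfolding holomorphic_on_def field_differentiable_def using g by blast
  show ?thesis
  proof (rule exI[of _ a], rule exI[of _ f], intro conjI ballI ma a0)
    show "f holomorphic_on ball 0 1" unfolding f_def[abs_def]
      by (intro holomorphic_intros ghol moderate_holomorphic[OF mp])
    show "{w \<in> ball 0 1. f w = 0} = range z" using p0 z_in by (auto simp: f_def)
    fix w :: complex assume w: "w \<in> ball 0 1"
    have eq: "deriv (deriv p) w + 2 * h w * deriv p w = (F w + 2 * (c * deriv p w)) * p w"
      using F(2)[OF w] by (simp add: R_def h_def algebra_simps)
    have "deriv (deriv f) w = (deriv (deriv p) w + 2 * h w * deriv p w + (deriv h w + (h w)\<^sup>2) * p w) * exp (g w)"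
      unfolding f_def[abs_def]
      by (rule deriv_deriv_mult_exp[OF _ moderate_holomorphic[OF mp] moderate_holomorphic[OF mh] g' w]) auto
    also have "\<dots> = - a w * f w" unfolding eq a_def f_def by (simp add: algebra_simps power2_eq_square)
    finally show "deriv (deriv f) w + a w * f w = 0" by simp
  qed
qed

end

section \<open>Counting functions and weights\<close>

text \<open>Each logarithm is the integral of \<open>1 / t\<close> from \<open>|z n - z k|\<close> to \<open>r\<close>; summing the indicators of these
  intervals counts the members other than \<open>z k\<close> itself, whence the subtracted \<open>1\<close>.\<close>

lemma sum_ln_le_integrated_count:
  fixes z :: "nat \<Rightarrow> complex"
  assumes I: "finite I" "k \<notin> I" and r: "\<And>n. n \<in> I \<Longrightarrow> 0 < norm (z n - z k) \<and> norm (z n - z k) \<le> r"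
  shows "ennreal (\<Sum>n\<in>I. ln (r / norm (z n - z k))) \<le> integrated_count z (z k) r"
proof -
  define \<rho> where "\<rho> n = norm (z n - z k)" for n
  have one: "(\<integral>\<^sup>+t. ennreal (1 / t) * indicator {\<rho> n..r} t \<partial>lborel) = ennreal (ln (r / \<rho> n))" if "n \<in> I" for n
  proof -
    have n: "0 < \<rho> n" "\<rho> n \<le> r" using r[OF that] by (auto simp: \<rho>_def)
    have "(\<integral>\<^sup>+t. ennreal (1 / t) * indicator {\<rho> n..r} t \<partial>lborel) = ennreal (ln r - ln (\<rho> n))"
    proof (rule nn_integral_FTC_Icc)
      fix x assume x: "x \<in> {\<rho> n..r}"
      hence "x > 0" using n by simp
      thus "DERIV ln x :> 1 / x" "0 \<le> 1 / x"
        by (auto intro!: derivative_eq_intros)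
    qed (use n in auto)
    thus ?thesis using n by (simp add: ln_div)
  qed
  have "ennreal (\<Sum>n\<in>I. ln (r / \<rho> n)) = (\<Sum>n\<in>I. ennreal (ln (r / \<rho> n)))"
    by (rule sum_ennreal[symmetric]) (use r in \<open>auto simp: \<rho>_def\<close>)
  also have "\<dots> = (\<Sum>n\<in>I. \<integral>\<^sup>+t. ennreal (1 / t) * indicator {\<rho> n..r} t \<partial>lborel)"
    by (rule sum.cong) (auto simp: one)
  also have "\<dots> = (\<integral>\<^sup>+t. (\<Sum>n\<in>I. ennreal (1 / t) * indicator {\<rho> n..r} t) \<partial>lborel)"
    by (rule nn_integral_sum[symmetric]) measurable
  also have "\<dots> \<le> integrated_count z (z k) r" unfolding integrated_count_def
  proof (rule nn_integral_mono)
    fix t :: real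
    define J where "J = {n\<in>I. \<rho> n \<le> t}"
    have J: "finite J" "k \<notin> J" using I by (auto simp: J_def)
    show "(\<Sum>n\<in>I. ennreal (1 / t) * indicator {\<rho> n..r} t)
       \<le> (seq_count z (z k) t - 1) / ennreal t * indicator {0<..r} t"
    proof (cases "0 < t \<and> t \<le> r")
      case False
      have "ennreal (1 / t) * indicator {\<rho> n..r} t = 0" if "n \<in> I" for n
      proof (cases "t \<in> {\<rho> n..r}")
        case True
        hence "0 < t \<and> t \<le> r" using r[OF that] unfolding \<rho>_def atLeastAtMost_iff by linarith
        thus ?thesis using False by simp
      qed simp
      hence "(\<Sum>n\<in>I. ennreal (1 / t) * indicator {\<rho> n..r} t) = 0" by (intro sum.neutral) blast
      thus ?thesis by simp
    next
      case True
      have "(\<Sum>n\<in>I. ennreal (1 / t) * indicator {\<rho> n..r} t) = (\<Sum>n\<in>J. ennreal (1 / t))"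
        using I True by (intro sum.mono_neutral_cong_right) (auto simp: J_def indicator_def)
      also have "\<dots> = of_nat (card J) / ennreal t"
        using True by (simp add: divide_ennreal_def inverse_ennreal inverse_eq_divide)
      also have "of_nat (card J) = of_nat (card (insert k J)) - (1 :: ennreal)"
        using J by (simp add: add.commute)
      also have "of_nat (card (insert k J)) = emeasure (count_space UNIV) (insert k J)"
        using J by (subst emeasure_count_space) auto
      also have "\<dots> \<le> seq_count z (z k) t" unfolding seq_count_def
        by (rule emeasure_mono) (use True in \<open>auto simp: J_def \<rho>_def\<close>)
      finally show ?thesis using True by (simp add: divide_right_mono_ennreal ennreal_minus_mono)
    qed
  qed
  finally show ?thesis by (simp add: \<rho>_def)
qed

text \<open>Beyond some point the doubling condition is the asymptotic one; below it, monotonicity and positivity bound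
  the ratio.\<close>

lemma doubling_constant:
  fixes \<psi> :: "real \<Rightarrow> real"
  assumes pos: "\<And>x. x \<ge> 1 \<Longrightarrow> \<psi> x > 0" and mono: "mono_on {1..} \<psi>"
    and dbl: "(\<lambda>x. \<psi> (2 * x)) \<in> O[at_top](\<psi>)"
  obtains s :: nat where "\<And>x. x \<ge> 1 \<Longrightarrow> \<psi> (2 * x) \<le> 2 ^ s * \<psi> x"
proof -
  obtain c where "eventually (\<lambda>x. norm (\<psi> (2 * x)) \<le> c * norm (\<psi> x)) at_top"
    using dbl by (auto elim: landau_o.bigE)
  then obtain x0 where x0: "\<And>x. x \<ge> x0 \<Longrightarrow> norm (\<psi> (2 * x)) \<le> c * norm (\<psi> x)"
    by (auto simp: eventually_at_top_linorder)
  define y where "y = max 1 x0"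
  have "\<exists>s. max c (\<psi> (2 * y) / \<psi> 1) < 2 ^ s" by (rule real_arch_pow) simp
  then obtain s :: nat where s: "max c (\<psi> (2 * y) / \<psi> 1) < 2 ^ s" ..
  show ?thesis
  proof (rule that[of s])
    fix x :: real assume x: "x \<ge> 1"
    show "\<psi> (2 * x) \<le> 2 ^ s * \<psi> x"
    proof (cases "x \<ge> x0")
      case True
      have "\<psi> (2 * x) \<le> c * \<psi> x" using x0[OF True] pos[OF x] pos[of "2 * x"] x by simp
      also have "\<dots> \<le> 2 ^ s * \<psi> x" using s pos[OF x] by (intro mult_right_mono) auto
      finally show ?thesis .
    next
      case False
      have "\<psi> (2 * x) \<le> \<psi> (2 * y)" by (rule mono_onD[OF mono]) (use x False in \<open>auto simp: y_def\<close>)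
      also have "\<dots> \<le> 2 ^ s * \<psi> 1" using s pos[of 1] by (simp add: divide_less_eq)
      also have "\<dots> \<le> 2 ^ s * \<psi> x" by (intro mult_left_mono mono_onD[OF mono]) (use x in auto)
      finally show ?thesis .
    qed
  qed
qed

text \<open>
  Doubling is assumed with a constant of the form \<open>2 ^ s\<close>, which is what makes \<open>\<psi> (2 ^ j)\<close> a growth scale.
\<close>

locale doubling_weight =
  fixes \<psi> :: "real \<Rightarrow> real" and s :: nat
  assumes psi_pos: "\<And>x. x \<ge> 1 \<Longrightarrow> \<psi> x > 0"
    and psi_mono: "mono_on {1..} \<psi>"
    and psi_double: "\<And>x. x \<ge> 1 \<Longrightarrow> \<psi> (2 * x) \<le> 2 ^ s * \<psi> x"
begin

sublocale growth_scale "\<lambda>j. \<psi> (2 ^ j)" s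
proof
  fix j :: nat
  have p: "(2::real) ^ j \<ge> 1" by simp
  show "\<psi> (2 ^ j) > 0" by (rule psi_pos[OF p])
  show "\<psi> (2 ^ Suc j) \<le> 2 ^ s * \<psi> (2 ^ j)" using psi_double[OF p] by simp
  show "\<psi> (2 ^ j) \<le> \<psi> (2 ^ Suc j)"
    by (rule mono_onD[OF psi_mono]) (use p one_le_power[of "2::real" "Suc j"] in auto)
qed

lemma psi_div_integrable:
  assumes a: "1 \<le> a"
  shows "(\<lambda>t. \<psi> t / t) integrable_on {a..b}"
proof (cases "a \<le> b")
  case True
  have "(\<lambda>t. 1 / t) integrable_on {a..b}"
    by (rule integrable_continuous_real) (use a in \<open>auto intro!: continuous_intros\<close>)
  \<comment> \<open>The second mean value theorem also provides the integrability of a product with a monotone factor.\<close>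
  thus ?thesis
  proof (rule second_mean_value_theorem_full[OF _ True])
    show "\<psi> x \<le> \<psi> y" if "a \<le> x" "x \<le> y" "y \<le> b" for x y
      by (rule mono_onD[OF psi_mono]) (use that a in auto)
  next
    fix c
    assume "((\<lambda>t. \<psi> t * (1 / t)) has_integral
      (\<psi> a * integral {a..c} (\<lambda>t. 1 / t) + \<psi> b * integral {c..b} (\<lambda>t. 1 / t))) {a..b}"
    thus ?thesis by (auto simp: integrable_on_def)
  qed
qed (simp add: integrable_on_empty)

lemma integral_psi_div_ge:
  assumes ab: "1 \<le> a" "a \<le> b"
  shows "\<psi> a * ln (b / a) \<le> integral {a..b} (\<lambda>t. \<psi> t / t)"
proof -
  have "((\<lambda>t. 1 / t) has_integral (ln b - ln a)) {a..b}"
  proof (rule fundamental_theorem_of_calculus[OF ab(2)])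
    fix x assume "x \<in> {a..b}"
    hence "x > 0" using ab by simp
    thus "(ln has_vector_derivative 1 / x) (at x within {a..b})"
      by (auto intro!: derivative_eq_intros simp flip: has_real_derivative_iff_has_vector_derivative)
  qed
  hence "((\<lambda>t. \<psi> a * (1 / t)) has_integral \<psi> a * (ln b - ln a)) {a..b}" by (rule has_integral_mult_right)
  moreover have "((\<lambda>t. \<psi> t / t) has_integral integral {a..b} (\<lambda>t. \<psi> t / t)) {a..b}"
    using psi_div_integrable[OF ab(1)] by blast
  ultimately have "\<psi> a * (ln b - ln a) \<le> integral {a..b} (\<lambda>t. \<psi> t / t)"
  proof (rule has_integral_le)
    fix x assume x: "x \<in> {a..b}"
    hence "\<psi> a \<le> \<psi> x" using ab by (intro mono_onD[OF psi_mono]) auto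
    thus "\<psi> a * (1 / x) \<le> \<psi> x / x" using x ab by (simp add: divide_right_mono)
  qed
  thus ?thesis using ab by (simp add: ln_div)
qed

lemma log_primitive_combine:
  assumes ab: "1 \<le> a" "a \<le> b"
  shows "log_primitive \<psi> b = log_primitive \<psi> a + integral {a..b} (\<lambda>t. \<psi> t / t)"
  unfolding log_primitive_def
  using Henstock_Kurzweil_Integration.integral_combine[OF ab psi_div_integrable[of 1 b]] by simp

lemma log_primitive_1: "log_primitive \<psi> 1 = 0"
  by (simp add: log_primitive_def)

lemma log_primitive_mono:
  assumes "1 \<le> x" "x \<le> y"
  shows "log_primitive \<psi> x \<le> log_primitive \<psi> y"
proof -
  have "0 \<le> \<psi> x * ln (y / x)" using assms psi_pos[of x] by simp
  thus ?thesis using log_primitive_combine[OF assms] integral_psi_div_ge[OF assms] by linarith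
qed

lemma T_le_log_primitive: "ln 2 * T m \<le> log_primitive \<psi> (2 ^ Suc m)"
proof (induction m)
  case 0
  show ?case using log_primitive_combine[of 1 2] integral_psi_div_ge[of 1 2]
    by (simp add: log_primitive_1 T_def mult.commute)
next
  case (Suc m)
  have p: "(1::real) \<le> 2 ^ Suc m" "(2::real) ^ Suc m \<le> 2 ^ Suc (Suc m)"
    by (rule one_le_power) auto
  have "\<psi> (2 ^ Suc m) * ln 2 \<le> integral {2 ^ Suc m..2 ^ Suc (Suc m)} (\<lambda>t. \<psi> t / t)"
    using integral_psi_div_ge[OF p] by simp
  moreover have "log_primitive \<psi> (2 ^ Suc (Suc m))
      = log_primitive \<psi> (2 ^ Suc m) + integral {2 ^ Suc m..2 ^ Suc (Suc m)} (\<lambda>t. \<psi> t / t)"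
    by (rule log_primitive_combine[OF p])
  moreover have "T (Suc m) = T m + \<psi> (2 ^ Suc m)" unfolding T_def by (rule sum.atMost_Suc)
  hence "ln 2 * T (Suc m) = ln 2 * T m + \<psi> (2 ^ Suc m) * ln 2"
    by (simp only: distrib_left mult.commute)
  ultimately show ?case using Suc.IH by linarith
qed

text \<open>
  At levels \<open>m \<ge> 1\<close> the scale \<open>T m\<close> is dominated by the integral. Near the origin the integral tends to \<open>0\<close>, and
  there the vanishing of \<open>a\<close> at \<open>0\<close> takes over: \<open>|a w| \<le> B |w| \<le> exp (B |w|)\<close>, while
  \<open>log_primitive \<psi> (1 / (1 - |w|)) \<ge> \<psi> 1 * |w|\<close>.
\<close>

lemma moderate_le_exp_log_primitive:
  assumes a: "moderate a" and a0: "a 0 = 0"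
  obtains C where "C > 0"
    "\<And>w. w \<in> ball 0 1 \<Longrightarrow> norm (a w) \<le> exp (C * log_primitive \<psi> (1 / (1 - norm w)))"
proof -
  have hol: "a holomorphic_on ball 0 1" by (rule moderate_holomorphic[OF a])
  obtain Ca where Ca: "Ca \<ge> 0" "\<And>w. w \<in> ball 0 1 \<Longrightarrow> norm (a w) \<le> exp (Ca * T (lev w))"
    using moderate_boundE[OF a] by blast
  obtain Cd where Cd: "Cd \<ge> 0" "\<And>w. w \<in> ball 0 1 \<Longrightarrow> norm (deriv a w) \<le> exp (Cd * T (lev w))"
    using moderate_boundE[OF moderate_deriv[OF a]] by blast
  define B where "B = exp (Cd * T (lev 0 + 1))"
  define C where "C = Ca * (1 + 2 ^ s) / ln 2 + B / \<psi> 1"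
  have B: "B > 0" by (simp add: B_def)
  have c1: "0 \<le> Ca * (1 + 2 ^ s) / ln 2" using Ca(1) by (simp add: add_nonneg_nonneg)
  have c2: "0 < B / \<psi> 1" using B psi_pos[of 1] by simp
  have C: "C > 0" using c1 c2 by (simp add: C_def)
  have bound: "norm (a w) \<le> exp (C * log_primitive \<psi> (1 / (1 - norm w)))" if w: "w \<in> ball 0 1" for w
  proof -
    define X where "X = 1 / (1 - norm w)"
    have X: "X \<ge> 1" using w by (simp add: X_def)
    have lpX: "log_primitive \<psi> X \<ge> 0" using log_primitive_mono[of 1 X] X log_primitive_1 by simp
    have part1: "Ca * (1 + 2 ^ s) / ln 2 * log_primitive \<psi> X \<le> C * log_primitive \<psi> X"
      by (rule mult_right_mono[OF _ lpX]) (use c2 in \<open>simp add: C_def\<close>)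
    have part2: "B / \<psi> 1 * log_primitive \<psi> X \<le> C * log_primitive \<psi> X"
      by (rule mult_right_mono[OF _ lpX]) (use c1 in \<open>simp add: C_def\<close>)
    show ?thesis
    proof (cases "lev w")
      case 0
      have half: "norm w < 1 / 2" using lev_gt[OF w] 0 by simp
      have "norm (a w - a 0) \<le> B * norm (w - 0)"
      proof (rule field_differentiable_bound[of "cball 0 (1/2)" a "deriv a"])
        fix v :: complex assume v: "v \<in> cball 0 (1/2)"
        hence v1: "v \<in> ball 0 1" by auto
        show "(a has_field_derivative deriv a v) (at v within cball 0 (1/2))"
          using holomorphic_derivI[OF hol _ v1] has_field_derivative_at_within by blast
        have "lev v \<le> lev 0 + 1" by (rule lev_mono) (use v v1 in auto)
        hence "Cd * T (lev v) \<le> Cd * T (lev 0 + 1)" by (intro mult_left_mono T_mono Cd)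
        with Cd(2)[OF v1] show "norm (deriv a v) \<le> B" unfolding B_def by (simp add: order_trans)
      qed (use half in auto)
      hence "norm (a w) \<le> B * norm w" by (simp add: a0)
      also have "\<dots> \<le> B * (log_primitive \<psi> X / \<psi> 1)"
      proof (intro mult_left_mono)
        have "1 - norm w \<le> exp (- norm w)" using exp_ge_add_one_self[of "- norm w"] by simp
        hence "exp (norm w) \<le> X" using w by (simp add: X_def exp_minus divide_simps mult_ac)
        hence "norm w \<le> ln X" using X by (simp add: ln_ge_iff)
        moreover have "\<psi> 1 * ln X \<le> log_primitive \<psi> X"
          using integral_psi_div_ge[of 1 X] X by (simp add: log_primitive_def)
        ultimately have "\<psi> 1 * norm w \<le> log_primitive \<psi> X"
          using mult_left_mono[of "norm w" "ln X" "\<psi> 1"] psi_pos[of 1] by linarith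
        thus "norm w \<le> log_primitive \<psi> X / \<psi> 1" using psi_pos[of 1] by (simp add: field_simps)
      qed (use B in auto)
      also have "\<dots> = B / \<psi> 1 * log_primitive \<psi> X" by simp
      also note part2
      also have "C * log_primitive \<psi> X \<le> exp (C * log_primitive \<psi> X)"
        using exp_ge_add_one_self[of "C * log_primitive \<psi> X"] by linarith
      finally show ?thesis by (simp add: X_def)
    next
      case (Suc m)
      have "T (Suc m) \<le> (1 + 2 ^ s) * T m" using T_shift[of m 1] by simp
      moreover have "ln 2 * T m \<le> log_primitive \<psi> X"
      proof -
        have "2 ^ Suc m * (1 - norm w) \<le> 1" using lev_le[OF w] Suc by simp
        hence "2 ^ Suc m \<le> X" using w by (simp add: X_def divide_simps)
        moreover have "(1::real) \<le> 2 ^ Suc m" by (rule one_le_power) simp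
        ultimately have "log_primitive \<psi> (2 ^ Suc m) \<le> log_primitive \<psi> X" by (intro log_primitive_mono)
        thus ?thesis using T_le_log_primitive[of m] by linarith
      qed
      hence "(1 + 2 ^ s) * T m \<le> (1 + 2 ^ s) * (log_primitive \<psi> X / ln 2)"
        by (intro mult_left_mono) (auto simp: field_simps intro!: add_nonneg_nonneg)
      ultimately have "T (lev w) \<le> (1 + 2 ^ s) * (log_primitive \<psi> X / ln 2)" using Suc by simp
      hence "Ca * T (lev w) \<le> Ca * ((1 + 2 ^ s) * (log_primitive \<psi> X / ln 2))" by (rule mult_left_mono[OF _ Ca(1)])
      also have "\<dots> = Ca * (1 + 2 ^ s) / ln 2 * log_primitive \<psi> X" by simp
      also note part1
      finally have "exp (Ca * T (lev w)) \<le> exp (C * log_primitive \<psi> X)" by simp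
      with Ca(2)[OF w] show ?thesis unfolding X_def by (rule order_trans)
    qed
  qed
  show ?thesis by (rule that[OF C bound])
qed

end

lemma max_modulus_le:
  assumes r: "0 \<le> r" and le: "\<And>w. norm w = r \<Longrightarrow> norm (g w) \<le> exp B"
  shows "ln_ext (max_modulus r g) \<le> ereal B"
proof -
  have w: "of_real r \<in> sphere (0::complex) r" using r by simp
  hence ne: "sphere (0::complex) r \<noteq> {}" by blast
  have bdd: "bdd_above ((\<lambda>w. norm (g w)) ` sphere 0 r)"
    by (rule bdd_aboveI[of _ "exp B"]) (use le in auto)
  have "max_modulus r g \<le> exp B" unfolding max_modulus_def
    by (rule cSUP_least[OF ne]) (use le in auto)
  moreover have "max_modulus r g \<ge> 0" unfolding max_modulus_def
    by (rule cSUP_upper2[OF bdd w]) simp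
  ultimately show ?thesis unfolding ln_ext_def
    using ln_le_cancel_iff[of "max_modulus r g" "exp B"] by auto
qed

section \<open>Prescribed zeros of solutions\<close>

theorem theorem6:
  fixes z :: "nat \<Rightarrow> complex" and \<psi> :: "real \<Rightarrow> real" and C1 :: real
  assumes z_disc: "\<And>n. z n \<in> ball 0 1"
    and z_distinct: "inj z"
    and psi_pos: "\<And>x. x \<ge> 1 \<Longrightarrow> \<psi> x > 0"
    and psi_mono: "mono_on {1..} \<psi>"
    and psi_unbounded: "\<not> bdd_above (\<psi> ` {1..})"
    and psi_doubling: "(\<lambda>x. \<psi> (2 * x)) \<in> O[at_top](\<psi>)"
    and C1_pos: "C1 > 0"
    and count_bound: "\<And>n. integrated_count z (z n) ((1 - norm (z n)) / 2)
                          \<le> ennreal (C1 * \<psi> (1 / (1 - norm (z n))))"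
  shows "\<exists>(a :: complex \<Rightarrow> complex) (C :: real).
           a analytic_on ball 0 1 \<and> C > 0 \<and>
           (\<forall>r\<in>{0<..<1}. ln_ext (max_modulus r a) \<le> ereal (C * log_primitive \<psi> (1 / (1 - r)))) \<and>
           (\<exists>f :: complex \<Rightarrow> complex.
              f analytic_on ball 0 1 \<and>
              (\<forall>w\<in>ball 0 1. deriv (deriv f) w + a w * f w = 0) \<and>
              {w\<in>ball 0 1. f w = 0} = range z)"
proof -
  obtain s :: nat where s: "\<And>x. x \<ge> 1 \<Longrightarrow> \<psi> (2 * x) \<le> 2 ^ s * \<psi> x"
    using doubling_constant[OF psi_pos psi_mono psi_doubling] by blast
  interpret doubling_weight \<psi> s
    by unfold_locales (fact psi_pos psi_mono s)+
  interpret zero_sequence "\<lambda>j. \<psi> (2 ^ j)" s z "C1 * 2 ^ s"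
  proof
    fix k :: nat and I :: "nat set"
    assume I: "finite I" "k \<notin> I"
      and near: "\<And>n. n \<in> I \<Longrightarrow> norm (z n - z k) \<le> (1 - norm (z k)) / 2"
    have pos: "1 - norm (z k) > 0" using z_disc[of k] by simp
    have nz: "0 < norm (z n - z k)" if "n \<in> I" for n
      using that I(2) z_distinct by (auto simp: inj_def)
    have "ennreal (\<Sum>n\<in>I. ln ((1 - norm (z k)) / 2 / norm (z n - z k)))
        \<le> integrated_count z (z k) ((1 - norm (z k)) / 2)"
      by (rule sum_ln_le_integrated_count) (use I near nz in auto)
    also have "\<dots> \<le> ennreal (C1 * \<psi> (1 / (1 - norm (z k))))" by (rule count_bound)
    finally have "(\<Sum>n\<in>I. ln ((1 - norm (z k)) / 2 / norm (z n - z k))) \<le> C1 * \<psi> (1 / (1 - norm (z k)))"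
      using C1_pos psi_pos[of "1 / (1 - norm (z k))"] pos by (subst (asm) ennreal_le_iff) auto
    also have "\<dots> \<le> C1 * \<psi> (2 * 2 ^ lev (z k))"
    proof (intro mult_left_mono mono_onD[OF psi_mono])
      show "1 / (1 - norm (z k)) \<le> 2 * 2 ^ lev (z k)"
        using lev_gt[OF z_disc[of k]] pos by (simp add: divide_simps mult_ac)
      show "2 * 2 ^ lev (z k) \<in> {1::real..}"
        using one_le_power[of "2::real" "Suc (lev (z k))"] by simp
    qed (use C1_pos pos in auto)
    also have "\<dots> \<le> C1 * (2 ^ s * \<psi> (2 ^ lev (z k)))"
      using C1_pos by (intro mult_left_mono s) auto
    finally show "(\<Sum>n\<in>I. ln ((1 - norm (z k)) / (2 * norm (z n - z k)))) \<le> C1 * 2 ^ s * \<psi> (2 ^ lev (z k))"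
      by simp
  qed (use z_disc z_distinct C1_pos in auto)
  obtain a f where a: "moderate a" "a 0 = 0" and f: "f holomorphic_on ball 0 1"
    "\<forall>w\<in>ball 0 1. deriv (deriv f) w + a w * f w = 0" "{w \<in> ball 0 1. f w = 0} = range z"
    using moderate_coefficient_exists by blast
  obtain C where C: "C > 0"
    "\<And>w. w \<in> ball 0 1 \<Longrightarrow> norm (a w) \<le> exp (C * log_primitive \<psi> (1 / (1 - norm w)))"
    using moderate_le_exp_log_primitive[OF a] by blast
  have "ln_ext (max_modulus r a) \<le> ereal (C * log_primitive \<psi> (1 / (1 - r)))" if "r \<in> {0<..<1}" for r
  proof (rule max_modulus_le)
    fix w :: complex assume "norm w = r"
    thus "norm (a w) \<le> exp (C * log_primitive \<psi> (1 / (1 - r)))" using C(2)[of w] that by simp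
  qed (use that in simp)
  moreover have "a analytic_on ball 0 1" "f analytic_on ball 0 1"
    using moderate_holomorphic[OF a(1)] f(1) by (auto simp: analytic_on_open)
  ultimately show ?thesis using C(1) f(2,3) by blast
qed

end
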